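(* Let $$(A,B)_{\rm can}=\bigoplus_{i=1}^{a}\mathcal H_{h_i}(\lambda_i)\ \oplus\ \bigoplus_{j=1}^{b}\mathcal K_{k_j}\ \oplus\ \bigoplus_{r=1}^{c}\mathcal L_{l_r}$$ be a pair of symmetric complex matrices in the congruence canonical form. Then the codimension of the congruence orbit of $(A,B)_{\rm can}$ equals $$\operatorname{codim}(A,B)_{\rm can}=c_{\mathcal H}+c_{\mathcal K}+c_{\mathcal L}+c_{\mathcal H\mathcal H}+c_{\mathcal K\mathcal K}+c_{\mathcal L\mathcal L}+c_{\mathcal H\mathcal K}+c_{\mathcal H\mathcal L}+c_{\mathcal K\mathcal L},$$ where $$c_{\mathcal H}=\sum_{i=1}^{a}h_i,\qquad c_{\mathcal K}=\sum_{j=1}^{b}k_j,\qquad c_{\mathcal L}=2\sum_{r=1}^{c}(l_r+1),$$ $$c_{\mathcal H\mathcal H}=\sum_{\substack{i<i'\\ \lambda_i=\lambda_{i'}}}\min(h_i,h_{i'}),\qquad c_{\mathcal K\mathcal K}=\sum_{j<j'}\min(k_j,k_{j'}),$$ $$c_{\mathcal L\mathcal L}=\sum_{r<r'}\bigl(2\max(l_r,l_{r'})+\varepsilon_{rr'}\bigr),\qquad \varepsilon_{rr'}=\begin{cases}2&\text{if }l_r=l_{r'},\\1&\text{if }l_r\ne l_{r'},\end{cases}$$ $$c_{\mathcal H\mathcal K}=0,\qquad c_{\mathcal H\mathcal L}=c\sum_{i=1}^{a}h_i,\qquad c_{\mathcal K\mathcal L}=c\sum_{j=1}^{b}k_j,$$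 with $c$ the number of summands of type $\mathcal L$.
   Context: All matrices are complex. $\Delta_n$ is the $n\times n$ matrix with entries $1$ at positions $(i,j)$ with $i+j=n+1$ and $0$ elsewhere. $\Lambda_n(\lambda)$, $\lambda\in\mathbb C$, is the $n\times n$ matrix with entries $\lambda$ at positions with $i+j=n+1$, entries $1$ at positions with $i+j=n+2$, and $0$ elsewhere. $F_n$ is the $n\times(n+1)$ matrix with $1$ at positions $(i,i)$, $1\le i\le n$, and $0$ elsewhere; $G_n$ is the $n\times(n+1)$ matrix with $1$ at positions $(i,i+1)$, $1\le i\le n$, and $0$ elsewhere. Put $$\mathcal H_n(\lambda)=(\Delta_n,\Lambda_n(\lambda)),\quad \mathcal K_n=(\Lambda_n(0),\Delta_n)\quad(n\ge1),\qquad \mathcal L_n=\left(\begin{bmatrix}0&F_n^T\\ F_n&0\end{bmatrix},\begin{bmatrix}0&G_n^T\\ G_n&0\end{bmatrix}\right)\quad(n\ge0),$$ where $\mathcal L_n$ has size $(2n+1)\times(2n+1)$ and $\mathcal L_0$ is the pair of $1\times1$ zero matrices. Direct sums of pairs are block diagonal. Every pair of symmetric complex matrices is congruent to a direct sum as in the claim, uniquely up to permutation of summands; this is its congruence canonical form. Two pairs $(A,B)$, $(C,D)$ of symmetric $N\times N$ matrices are congruent if $S^TAS=C$ and $S^TBS=D$ for some nonsingular $S$; the congruence orbit of $(A,B)$ is the set of pairs congruent to it. The tangent space to the congruence orbit at $(A,B)$ is $$T_{(A,B)}=\{(X^TA+AX,\ X^TB+BX)\ :\ X\in\mathbb C^{N\times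 N}\}.$$ The codimension of the congruence orbit, $\operatorname{codim}(A,B)$, is the complex dimension of the normal space at $(A,B)$, i.e. of the orthogonal complement of $T_{(A,B)}$ in the space of pairs of symmetric complex $N\times N$ matrices (a space of dimension $N(N+1)$). *)

theory Defs
  imports Complex_Main "Jordan_Normal_Form.VS_Connect"
begin

text \<open>Rows, columns and summands are indexed from 0, so that a mathematical condition
  $i+j=n+1$ on 1-based indices reads \<^term>\<open>i + j + 1 = n\<close> here, and $i+j=n+2$ reads
  \<^term>\<open>i + j = n\<close>.\<close>

type_synonym mat_pair = "complex mat \<times> complex mat"

definition Delta_mat :: "nat \<Rightarrow> complex mat" where
  "Delta_mat n = mat n n (\<lambda>(i, j). if i + j + 1 = n then 1 else 0)"

definition Lambda_mat :: "nat \<Rightarrow> complex \<Rightarrow> complex mat" where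
  "Lambda_mat n l = mat n n (\<lambda>(i, j). if i + j + 1 = n then l else if i + j = n then 1 else 0)"

definition F_mat :: "nat \<Rightarrow> complex mat" where
  "F_mat n = mat n (n + 1) (\<lambda>(i, j). if j = i then 1 else 0)"

definition G_mat :: "nat \<Rightarrow> complex mat" where
  "G_mat n = mat n (n + 1) (\<lambda>(i, j). if j = i + 1 then 1 else 0)"

definition H_pair :: "nat \<Rightarrow> complex \<Rightarrow> mat_pair" where
  "H_pair n l = (Delta_mat n, Lambda_mat n l)"

definition K_pair :: "nat \<Rightarrow> mat_pair" where
  "K_pair n = (Lambda_mat n 0, Delta_mat n)"

definition L_pair :: "nat \<Rightarrow> mat_pair" where
  "L_pair n =
    (four_block_mat (0\<^sub>m (n + 1) (n + 1)) (transpose_mat (F_mat n)) (F_mat n) (0\<^sub>m n n),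
     four_block_mat (0\<^sub>m (n + 1) (n + 1)) (transpose_mat (G_mat n)) (G_mat n) (0\<^sub>m n n))"

definition direct_sum_pairs :: "mat_pair list \<Rightarrow> mat_pair" where
  "direct_sum_pairs ps = (diag_block_mat (map fst ps), diag_block_mat (map snd ps))"

definition canonical_pair ::
  "nat \<Rightarrow> (nat \<Rightarrow> nat) \<Rightarrow> (nat \<Rightarrow> complex) \<Rightarrow> nat \<Rightarrow> (nat \<Rightarrow> nat) \<Rightarrow> nat \<Rightarrow> (nat \<Rightarrow> nat) \<Rightarrow> mat_pair"
  where
  "canonical_pair a h lam b k c l = direct_sum_pairs
    (map (\<lambda>i. H_pair (h i) (lam i)) [0..<a] @
     map (\<lambda>j. K_pair (k j)) [0..<b] @
     map (\<lambda>r. L_pair (l r)) [0..<c])"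

definition symmetric_pairs :: "nat \<Rightarrow> mat_pair set" where
  "symmetric_pairs N = {(C, D). C \<in> carrier_mat N N \<and> D \<in> carrier_mat N N \<and>
    transpose_mat C = C \<and> transpose_mat D = D}"

definition tangent_space :: "mat_pair \<Rightarrow> mat_pair set" where
  "tangent_space = (\<lambda>(A, B).
    {(transpose_mat X * A + A * X, transpose_mat X * B + B * X) | X.
      X \<in> carrier_mat (dim_row A) (dim_row A)})"

text \<open>The Frobenius inner product $\mathrm{tr}(CA^*) + \mathrm{tr}(DB^*)$ of the pairs
  $(C,D)$ and $(A,B)$.\<close>

definition frobenius_inner :: "complex mat \<Rightarrow> complex mat \<Rightarrow> complex" where
  "frobenius_inner C A = (\<Sum>i<dim_row C. \<Sum>j<dim_col C. C $$ (i, j) * cnj (A $$ (i, j)))"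

definition pair_inner :: "mat_pair \<Rightarrow> mat_pair \<Rightarrow> complex" where
  "pair_inner = (\<lambda>(C, D) (A, B). frobenius_inner C A + frobenius_inner D B)"

definition normal_space :: "mat_pair \<Rightarrow> mat_pair set" where
  "normal_space P = {Q \<in> symmetric_pairs (dim_row (fst P)).
    \<forall>T \<in> tangent_space P. pair_inner Q T = 0}"

definition pair_space :: "nat \<Rightarrow> (complex, mat_pair) module" where
  "pair_space N = direct_sum (module_mat TYPE(complex) N N) (module_mat TYPE(complex) N N)"

text \<open>The codimension of the congruence orbit of a pair: the complex dimension of its normal
  space, regarded as a subspace of all pairs of square matrices of that size.\<close>

definition codim_congruence_orbit :: "mat_pair \<Rightarrow> nat" where
  "codim_congruence_orbit P =
    vectorspace.dim class_ring (pair_space (dim_row (fst P))\<lparr>carrier := normal_space P\<rparr>)"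

end

theory Submission
  imports Defs
begin

text \<open>
  Let $(A,B)$ be a pair of symmetric matrices. A symmetric pair $(C,D)$ is orthogonal to all
  $(X^TA + AX, X^TB + BX)$ iff $\mathrm{tr}((C\overline{A} + D\overline{B})\overline{X}) = 0$ for
  every $X$, that is, iff $C\overline{A} + D\overline{B} = 0$. After entrywise conjugation of $C$ and
  $D$ the codimension is therefore the dimension of the space of symmetric solutions of
  $CA + DB = 0$ (\<open>normal_space_iff\<close>, \<open>codim_eq_if_sym_dim\<close>).

  For a block diagonal pair with blocks $(A_i,B_i)$ this equation decouples. A diagonal block of
  $(C,D)$ is a symmetric solution of the problem for $(A_i,B_i)$. A block in position $(i,j)$ with
  $i<j$ has to satisfy $C_{ij}A_j + D_{ij}B_j = 0$ and, because its transpose sits in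
  position $(j,i)$, also $C_{ij}^TA_i + D_{ij}^TB_i = 0$. So the codimension is a sum of one number
  per summand and one number per pair of summands (\<open>sym_dim_sum\<close>, \<open>cross_dim_sum\<close>).

  Both kinds of equations constrain the rows of the unknown matrices by conditions
  $xA + yB = 0$, and such a condition is unchanged when the columns of $A$ and $B$ are permuted
  simultaneously. Up to such a permutation $\mathcal L_n$ is the direct sum of the rectangular
  pairs $(F_n^T,G_n^T)$ and $(F_n,G_n)$, so that only four elementary row conditions remain: those
  of $\mathcal H_n(\lambda)$, $\mathcal K_n$, $(F_n^T,G_n^T)$ and $(F_n,G_n)$. For two of them the
  equations say that certain entries agree along diagonals or antidiagonals, or that each column
  determines its neighbour. The solutions can be written down, and in every case there is a set of
  matrix positions whose entries can be prescribed arbitrarily and determine the solution. Counting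
  these free positions gives $\min(n,m)$ for two blocks with the same eigenvalue, $0$ for different
  eigenvalues, $n$ for a block of size $n$ against some $(F_m^T,G_m^T)$, $p+q+2$ for
  $(F_p^T,G_p^T)$ against $(F_q^T,G_q^T)$, $\max(0,q-p-1)$ for $(F_p^T,G_p^T)$ against $(F_q,G_q)$,
  and $0$ in the remaining cases. For equal conditions every solution is symmetric, which supplies
  the diagonal blocks.
\<close>

section \<open>Matrix equations as conditions on rows\<close>

text \<open>A pair $(C,D)$ of matrices is stored as one function \<open>w\<close> with \<open>w False i j\<close> $= C_{ij}$ and
  \<open>w True i j\<close> $= D_{ij}$, so that a single triple of indices names a coordinate of the pair.
  Only indices inside the given number of rows and columns carry meaning.\<close>
type_synonym pencil = "bool \<Rightarrow> nat \<Rightarrow> nat \<Rightarrow> complex"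

text \<open>A row condition of length $n$ is a predicate on pairs $(x,y)$ of vectors of length $n$. The
  instances of interest are the conditions $x A + y B = 0$ attached to a pair $(A,B)$ with $n$ rows.
  Keeping only the predicate allows rectangular pairs and forgets the order in which the columns of
  $A$ and $B$ are written.\<close>
type_synonym row_cond = "nat \<times> ((bool \<Rightarrow> nat \<Rightarrow> complex) \<Rightarrow> bool)"

text \<open>Vectors are total functions on the natural numbers, so a condition has to be told not to look
  beyond its length.\<close>
definition is_local :: "row_cond \<Rightarrow> bool" where
  "is_local P \<longleftrightarrow> (\<forall>x y. (\<forall>s. \<forall>k<fst P. x s k = y s k) \<longrightarrow> snd P x \<longrightarrow> snd P y)"

text \<open>For the conditions of two pairs $(A_1,B_1)$ and $(A_2,B_2)$ these are the $(C,D)$ with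
  $CA_2 + DB_2 = 0$ and $C^TA_1 + D^TB_1 = 0$: rows obey the second condition, columns the first.
  They are the blocks in position $(1,2)$ of the symmetric solutions for the direct sum.\<close>
definition cross_solutions :: "row_cond \<Rightarrow> row_cond \<Rightarrow> pencil set" where
  "cross_solutions P Q = {w. (\<forall>i<fst P. snd Q (\<lambda>s. w s i)) \<and> (\<forall>j<fst Q. snd P (\<lambda>s i. w s i j))}"

definition sym_solutions :: "row_cond \<Rightarrow> pencil set" where
  "sym_solutions P = {w. (\<forall>s. \<forall>i<fst P. \<forall>j<fst P. w s i j = w s j i) \<and> (\<forall>i<fst P. snd P (\<lambda>s. w s i))}"

text \<open>Free coordinates play the role of the non-pivot variables of a homogeneous linear system: they take
  arbitrary values on the solutions, and a solution vanishing on them vanishes. For a linear system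
  their number is the dimension of the solution space. The function \<open>f\<close>
  prescribes the values on \<open>F\<close>.\<close>
definition free_coordinates :: "pencil set \<Rightarrow> nat \<Rightarrow> nat \<Rightarrow> (bool \<times> nat \<times> nat) set \<Rightarrow> bool" where
  "free_coordinates S n m F \<longleftrightarrow> F \<subseteq> UNIV \<times> {..<n} \<times> {..<m} \<and>
    (\<forall>f. \<exists>w\<in>S. \<forall>s i j. (s, i, j) \<in> F \<longrightarrow> w s i j = f s i j) \<and>
    (\<forall>w\<in>S. (\<forall>s i j. (s, i, j) \<in> F \<longrightarrow> w s i j = 0) \<longrightarrow> (\<forall>s. \<forall>i<n. \<forall>j<m. w s i j = 0))"

definition has_dim :: "pencil set \<Rightarrow> nat \<Rightarrow> nat \<Rightarrow> nat \<Rightarrow> bool" where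
  "has_dim S n m d \<longleftrightarrow> (\<exists>F. free_coordinates S n m F \<and> card F = d)"

abbreviation cross_dim :: "row_cond \<Rightarrow> row_cond \<Rightarrow> nat \<Rightarrow> bool" where
  "cross_dim P Q d \<equiv> has_dim (cross_solutions P Q) (fst P) (fst Q) d"

abbreviation sym_dim :: "row_cond \<Rightarrow> nat \<Rightarrow> bool" where
  "sym_dim P d \<equiv> has_dim (sym_solutions P) (fst P) (fst P) d"

text \<open>The condition of a block diagonal pair: the vector is cut after its first \<open>fst P\<close> entries.\<close>
definition cond_sum :: "row_cond \<Rightarrow> row_cond \<Rightarrow> row_cond" where
  "cond_sum P Q = (fst P + fst Q, \<lambda>x. snd P x \<and> snd Q (\<lambda>s k. x s (fst P + k)))"

text \<open>The effect of passing from the pair $(A,B)$ to $(B,A)$.\<close>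
definition cond_swap :: "row_cond \<Rightarrow> row_cond" where
  "cond_swap P = (fst P, \<lambda>x. snd P (\<lambda>s. x (\<not> s)))"

lemma free_coordinatesD:
  assumes "free_coordinates S n m F"
  shows "finite F" "F \<subseteq> UNIV \<times> {..<n} \<times> {..<m}"
    "\<exists>w\<in>S. \<forall>s i j. (s, i, j) \<in> F \<longrightarrow> w s i j = f s i j"
    "\<lbrakk>w \<in> S; \<And>s i j. (s, i, j) \<in> F \<Longrightarrow> w s i j = 0; i < n; j < m\<rbrakk> \<Longrightarrow> w s i j = 0"
proof -
  show sub: "F \<subseteq> UNIV \<times> {..<n} \<times> {..<m}"
    using assms by (simp add: free_coordinates_def)
  show "finite F" by (rule finite_subset[OF sub]) simp
  show "\<exists>w\<in>S. \<forall>s i j. (s, i, j) \<in> F \<longrightarrow> w s i j = f s i j"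
    using assms unfolding free_coordinates_def by blast
  show "\<lbrakk>w \<in> S; \<And>s i j. (s, i, j) \<in> F \<Longrightarrow> w s i j = 0; i < n; j < m\<rbrakk> \<Longrightarrow> w s i j = 0"
    using assms unfolding free_coordinates_def by blast
qed

lemma free_coordinatesI:
  assumes "F \<subseteq> UNIV \<times> {..<n} \<times> {..<m}"
    and "\<And>f. \<exists>w\<in>S. \<forall>s i j. (s, i, j) \<in> F \<longrightarrow> w s i j = f s i j"
    and "\<And>w s i j. \<lbrakk>w \<in> S; \<And>s i j. (s, i, j) \<in> F \<Longrightarrow> w s i j = 0; i < n; j < m\<rbrakk> \<Longrightarrow> w s i j = 0"
  shows "free_coordinates S n m F"
  using assms unfolding free_coordinates_def by blast

text \<open>The two conditions on a cross solution are exchanged by $(C,D) \mapsto (C^T,D^T)$, which permutes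
  the coordinates.\<close>
lemma cross_dim_transpose:
  assumes "cross_dim P Q d"
  shows "cross_dim Q P d"
proof -
  let ?t = "\<lambda>(s::bool, i::nat, j::nat). (s, j, i)"
  let ?T = "\<lambda>w::pencil. (\<lambda>s i j. w s j i)"
  from assms obtain F where F: "free_coordinates (cross_solutions P Q) (fst P) (fst Q) F" and c: "card F = d"
    by (auto simp: has_dim_def)
  have T: "?T w \<in> cross_solutions Q P \<longleftrightarrow> w \<in> cross_solutions P Q" for w
    by (auto simp: cross_solutions_def)
  have mem: "(s, i, j) \<in> ?t ` F \<longleftrightarrow> (s, j, i) \<in> F" for s i j by force
  have "free_coordinates (cross_solutions Q P) (fst Q) (fst P) (?t ` F)"
  proof (rule free_coordinatesI)
    show "?t ` F \<subseteq> UNIV \<times> {..<fst Q} \<times> {..<fst P}" using free_coordinatesD(2)[OF F] by force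
    show "\<exists>w\<in>cross_solutions Q P. \<forall>s i j. (s, i, j) \<in> ?t ` F \<longrightarrow> w s i j = f s i j" for f
    proof -
      obtain w where "w \<in> cross_solutions P Q" "\<forall>s i j. (s, i, j) \<in> F \<longrightarrow> w s i j = ?T f s i j"
        using free_coordinatesD(3)[OF F, of "?T f"] by blast
      then show ?thesis by (intro bexI[of _ "?T w"]) (auto simp: mem T)
    qed
    show "w s i j = 0" if "w \<in> cross_solutions Q P" "\<And>s i j. (s, i, j) \<in> ?t ` F \<Longrightarrow> w s i j = 0"
        "i < fst Q" "j < fst P" for w s i j
      using free_coordinatesD(4)[OF F, of "?T w" j i s] that by (auto simp: mem cross_solutions_def)
  qed
  moreover have "card (?t ` F) = d" unfolding c[symmetric] by (rule card_image) (auto simp: inj_on_def)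
  ultimately show ?thesis by (auto simp: has_dim_def)
qed

lemma has_dim_swap:
  assumes "has_dim S n m d" and eq: "\<And>w. (\<lambda>s. w (\<not> s)) \<in> S' \<longleftrightarrow> w \<in> S"
  shows "has_dim S' n m d"
proof -
  let ?t = "\<lambda>(s, i::nat, j::nat). (\<not> s, i, j)"
  let ?T = "\<lambda>w::pencil. (\<lambda>s. w (\<not> s))"
  from assms obtain F where F: "free_coordinates S n m F" and c: "card F = d"
    by (auto simp: has_dim_def)
  have mem: "(s, i, j) \<in> ?t ` F \<longleftrightarrow> (\<not> s, i, j) \<in> F" for s i j by force
  have "free_coordinates S' n m (?t ` F)"
  proof (rule free_coordinatesI)
    show "?t ` F \<subseteq> UNIV \<times> {..<n} \<times> {..<m}" using free_coordinatesD(2)[OF F] by force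
    show "\<exists>w\<in>S'. \<forall>s i j. (s, i, j) \<in> ?t ` F \<longrightarrow> w s i j = f s i j" for f
    proof -
      obtain w where "w \<in> S" "\<forall>s i j. (s, i, j) \<in> F \<longrightarrow> w s i j = ?T f s i j"
        using free_coordinatesD(3)[OF F, of "?T f"] by blast
      then show ?thesis by (intro bexI[of _ "?T w"]) (auto simp: mem eq)
    qed
    show "w s i j = 0" if w: "w \<in> S'" and z: "\<And>s i j. (s, i, j) \<in> ?t ` F \<Longrightarrow> w s i j = 0"
        and ij: "i < n" "j < m" for w s i j
    proof -
      have "?T w \<in> S" using w by (simp flip: eq)
      then have "?T w (\<not> s) i j = 0"
      proof (rule free_coordinatesD(4)[OF F _ _ ij])
        fix s i j assume "(s, i, j) \<in> F"
        then have "(\<not> s, i, j) \<in> ?t ` F" by force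
        then show "?T w s i j = 0" by (rule z)
      qed
      then show ?thesis by simp
    qed
  qed
  moreover have "card (?t ` F) = d" unfolding c[symmetric] by (rule card_image) (auto simp: inj_on_def)
  ultimately show ?thesis by (auto simp: has_dim_def)
qed

lemma cross_dim_swap:
  assumes "cross_dim P Q d"
  shows "cross_dim (cond_swap P) (cond_swap Q) d"
proof -
  have "(\<lambda>s. w (\<not> s)) \<in> cross_solutions (cond_swap P) (cond_swap Q) \<longleftrightarrow> w \<in> cross_solutions P Q" for w
    by (simp add: cond_swap_def cross_solutions_def)
  from has_dim_swap[OF assms this] show ?thesis by (simp add: cond_swap_def)
qed

lemma sym_dim_swap:
  assumes "sym_dim P d"
  shows "sym_dim (cond_swap P) d"
proof -
  have "(\<lambda>s. w (\<not> s)) \<in> sym_solutions (cond_swap P) \<longleftrightarrow> w \<in> sym_solutions P" for w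
    by (auto simp: cond_swap_def sym_solutions_def all_bool_eq)
  from has_dim_swap[OF assms this] show ?thesis by (simp add: cond_swap_def)
qed

lemma is_localD: "is_local P \<Longrightarrow> snd P x \<Longrightarrow> (\<And>s k. k < fst P \<Longrightarrow> x s k = y s k) \<Longrightarrow> snd P y"
  unfolding is_local_def by blast

lemma sym_solutionsD:
  assumes "w \<in> sym_solutions P" "i < fst P"
  shows "snd P (\<lambda>s. w s i)" "j < fst P \<Longrightarrow> w s i j = w s j i"
  using assms unfolding sym_solutions_def by blast+

lemma sym_solutionsI:
  assumes "\<And>s i j. i < fst P \<Longrightarrow> j < fst P \<Longrightarrow> w s i j = w s j i"
    and "\<And>i. i < fst P \<Longrightarrow> snd P (\<lambda>s. w s i)"
  shows "w \<in> sym_solutions P"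
  using assms unfolding sym_solutions_def by blast

lemma cross_solutionsD:
  assumes "w \<in> cross_solutions P Q"
  shows "i < fst P \<Longrightarrow> snd Q (\<lambda>s. w s i)" "j < fst Q \<Longrightarrow> snd P (\<lambda>s i. w s i j)"
  using assms unfolding cross_solutions_def by blast+

lemma cross_solutionsI:
  assumes "\<And>i. i < fst P \<Longrightarrow> snd Q (\<lambda>s. w s i)" "\<And>j. j < fst Q \<Longrightarrow> snd P (\<lambda>s i. w s i j)"
  shows "w \<in> cross_solutions P Q"
  using assms unfolding cross_solutions_def by blast

text \<open>A symmetric solution is the same as a symmetric cross solution of the condition with itself. For
  each of the elementary conditions below every such cross solution turns out to be symmetric, which
  makes the two counts equal.\<close>
lemma sym_dim_if_cross_symmetric:
  assumes "cross_dim P P d"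
    and sym: "\<And>w s i j. \<lbrakk>w \<in> cross_solutions P P; i < fst P; j < fst P\<rbrakk> \<Longrightarrow> w s i j = w s j i"
    and loc: "is_local P"
  shows "sym_dim P d"
proof -
  have "sym_solutions P \<subseteq> cross_solutions P P"
  proof (intro subsetI cross_solutionsI)
    fix w j assume w: "w \<in> sym_solutions P" and j: "j < fst P"
    show "snd P (\<lambda>s. w s j)" by (rule sym_solutionsD(1)[OF w j])
    then show "snd P (\<lambda>s i. w s i j)"
      by (rule is_localD[OF loc]) (rule sym_solutionsD(2)[OF w j])
  qed
  moreover have "cross_solutions P P \<subseteq> sym_solutions P"
    by (intro subsetI sym_solutionsI sym cross_solutionsD(1))
  ultimately show ?thesis using assms(1) by (simp add: subset_antisym)
qed

lemma is_localI: "(\<And>x y. (\<And>s k. k < fst P \<Longrightarrow> x s k = y s k) \<Longrightarrow> snd P x \<Longrightarrow> snd P y) \<Longrightarrow> is_local P"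
  unfolding is_local_def by blast

lemma is_local_sum [intro]:
  assumes "is_local P" "is_local Q"
  shows "is_local (cond_sum P Q)"
proof (rule is_localI)
  fix x y :: "bool \<Rightarrow> nat \<Rightarrow> complex"
  assume eq: "\<And>s k. k < fst (cond_sum P Q) \<Longrightarrow> x s k = y s k" and x: "snd (cond_sum P Q) x"
  have "snd P y" by (rule is_localD[OF assms(1), of x]) (use eq x in \<open>auto simp: cond_sum_def\<close>)
  moreover have "snd Q (\<lambda>s k. y s (fst P + k))"
    by (rule is_localD[OF assms(2), of "\<lambda>s k. x s (fst P + k)"]) (use eq x in \<open>auto simp: cond_sum_def\<close>)
  ultimately show "snd (cond_sum P Q) y" by (simp add: cond_sum_def)
qed

lemma is_local_swap [intro]: "is_local P \<Longrightarrow> is_local (cond_swap P)"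
  by (rule is_localI) (auto simp: cond_swap_def elim!: is_localD)

lemma all_less_add: "(\<forall>j<n + m. R j) \<longleftrightarrow> (\<forall>j<n. R j) \<and> (\<forall>j<m. R (n + j))" for n m :: nat
  by (metis add_diff_inverse_nat nat_add_left_cancel_less trans_less_add1)

lemma cross_solutions_sum:
  "w \<in> cross_solutions P (cond_sum Q1 Q2) \<longleftrightarrow>
    w \<in> cross_solutions P Q1 \<and> (\<lambda>s i j. w s i (fst Q1 + j)) \<in> cross_solutions P Q2"
  using all_less_add[of "fst Q1" "fst Q2" "\<lambda>j. snd P (\<lambda>s i. w s i j)"]
  unfolding cross_solutions_def cond_sum_def by auto

text \<open>Cut a symmetric solution into four blocks. The diagonal blocks are symmetric solutions for the
  summands; the off-diagonal blocks are transposes of each other, and the condition on the rows of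
  the lower one is the condition on the columns of the upper one.\<close>
lemma sym_solutions_sum:
  assumes "is_local P"
  shows "w \<in> sym_solutions (cond_sum P Q) \<longleftrightarrow>
    w \<in> sym_solutions P \<and> (\<lambda>s i j. w s i (fst P + j)) \<in> cross_solutions P Q \<and>
    (\<lambda>s i j. w s (fst P + i) (fst P + j)) \<in> sym_solutions Q \<and>
    (\<forall>s. \<forall>i<fst P. \<forall>j<fst Q. w s (fst P + j) i = w s i (fst P + j))"
    (is "?l \<longleftrightarrow> ?P \<and> ?PQ \<and> ?Q \<and> ?sym")
proof
  assume l: ?l
  note row = sym_solutionsD(1)[OF l] and sym = sym_solutionsD(2)[OF l]
  have sym': ?sym by (auto intro!: sym simp: cond_sum_def)
  have "snd P (\<lambda>s i. w s i (fst P + j))" if j: "j < fst Q" for j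
  proof (rule is_localD[OF assms])
    show "snd P (\<lambda>s. w s (fst P + j))" using row[of "fst P + j"] j by (simp add: cond_sum_def)
  qed (use sym' j in blast)
  then have ?PQ using row by (intro cross_solutionsI) (auto simp: cond_sum_def)
  moreover have ?P using row by (intro sym_solutionsI sym) (auto simp: cond_sum_def)
  moreover have ?Q using row by (intro sym_solutionsI sym) (auto simp: cond_sum_def)
  ultimately show "?P \<and> ?PQ \<and> ?Q \<and> ?sym" using sym' by blast
next
  assume "?P \<and> ?PQ \<and> ?Q \<and> ?sym"
  then have P: ?P and PQ: ?PQ and Q: ?Q and sym: ?sym by blast+
  have "snd P (\<lambda>s. w s (fst P + j))" if j: "j < fst Q" for j
    by (rule is_localD[OF assms cross_solutionsD(2)[OF PQ j]]) (use sym j in auto)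
  then have "\<forall>i<fst P + fst Q. snd (cond_sum P Q) (\<lambda>s. w s i)"
    unfolding all_less_add
    using sym_solutionsD(1)[OF P] cross_solutionsD(1)[OF PQ] sym_solutionsD(1)[OF Q]
    by (simp add: cond_sum_def)
  moreover have "\<forall>i<fst P + fst Q. \<forall>j<fst P + fst Q. w s i j = w s j i" for s
    unfolding all_less_add using sym sym_solutionsD(2)[OF P] sym_solutionsD(2)[OF Q]
    by (metis (no_types, lifting))
  ultimately show ?l by (intro sym_solutionsI) (auto simp: cond_sum_def)
qed

section \<open>Dimension counts for direct sums\<close>

text \<open>The solution space is a product, and the free coordinates of the two factors, placed side by side,
  are free coordinates of the product.\<close>
lemma cross_dim_sum:
  assumes 1: "cross_dim P Q1 d1" and 2: "cross_dim P Q2 d2" and loc: "is_local Q1"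
  shows "cross_dim P (cond_sum Q1 Q2) (d1 + d2)"
proof -
  let ?m = "fst Q1"
  let ?t = "\<lambda>(s::bool, i::nat, j). (s, i, ?m + j)"
  from 1 obtain F1 where F1: "free_coordinates (cross_solutions P Q1) (fst P) ?m F1" and c1: "card F1 = d1"
    by (auto simp: has_dim_def)
  from 2 obtain F2 where F2: "free_coordinates (cross_solutions P Q2) (fst P) (fst Q2) F2" and c2: "card F2 = d2"
    by (auto simp: has_dim_def)
  let ?F = "F1 \<union> ?t ` F2"
  have in_range: "j < ?m" if "(s, i, j) \<in> F1" for s i j using free_coordinatesD(2)[OF F1] that by auto
  have "free_coordinates (cross_solutions P (cond_sum Q1 Q2)) (fst P) (?m + fst Q2) ?F"
  proof (rule free_coordinatesI)
    show "?F \<subseteq> UNIV \<times> {..<fst P} \<times> {..<?m + fst Q2}"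
      using free_coordinatesD(2)[OF F1] free_coordinatesD(2)[OF F2] by fastforce
    fix f
    obtain w1 where w1: "w1 \<in> cross_solutions P Q1" "\<forall>s i j. (s, i, j) \<in> F1 \<longrightarrow> w1 s i j = f s i j"
      using free_coordinatesD(3)[OF F1, of f] by blast
    obtain w2 where w2: "w2 \<in> cross_solutions P Q2" "\<forall>s i j. (s, i, j) \<in> F2 \<longrightarrow> w2 s i j = f s i (?m + j)"
      using free_coordinatesD(3)[OF F2, of "\<lambda>s i j. f s i (?m + j)"] by blast
    define w where "w = (\<lambda>s i j. if j < ?m then w1 s i j else w2 s i (j - ?m))"
    have "w \<in> cross_solutions P Q1"
    proof (rule cross_solutionsI)
      show "snd Q1 (\<lambda>s. w s i)" if "i < fst P" for i
        by (rule is_localD[OF loc cross_solutionsD(1)[OF w1(1) that]]) (simp add: w_def)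
      show "snd P (\<lambda>s i. w s i j)" if "j < fst Q1" for j
        using cross_solutionsD(2)[OF w1(1) that] that by (simp add: w_def)
    qed
    moreover have "(\<lambda>s i j. w s i (?m + j)) \<in> cross_solutions P Q2"
      using w2(1) by (simp add: w_def)
    ultimately have "w \<in> cross_solutions P (cond_sum Q1 Q2)" by (simp add: cross_solutions_sum)
    moreover have "\<forall>s i j. (s, i, j) \<in> ?F \<longrightarrow> w s i j = f s i j"
      using w1(2) w2(2) in_range by (auto simp: w_def)
    ultimately show "\<exists>w\<in>cross_solutions P (cond_sum Q1 Q2). \<forall>s i j. (s, i, j) \<in> ?F \<longrightarrow> w s i j = f s i j"
      by blast
  next
    fix w s i j
    assume w: "w \<in> cross_solutions P (cond_sum Q1 Q2)"
      and z: "\<And>s i j. (s, i, j) \<in> ?F \<Longrightarrow> w s i j = 0" and ij: "i < fst P" "j < ?m + fst Q2"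
    note parts = w[unfolded cross_solutions_sum]
    have "w s i j = 0" if "j < ?m" for j
      by (rule free_coordinatesD(4)[OF F1 conjunct1[OF parts] _ ij(1) that]) (simp add: z)
    moreover have "w s i (?m + j) = 0" if "j < fst Q2" for j
      by (rule free_coordinatesD(4)[OF F2 conjunct2[OF parts] _ ij(1) that]) (rule z, force)
    ultimately show "w s i j = 0"
      using all_less_add[of ?m "fst Q2" "\<lambda>j. w s i j = 0"] ij(2) by blast
  qed
  moreover have "card ?F = d1 + d2"
  proof -
    have "card (?t ` F2) = d2" unfolding c2[symmetric] by (rule card_image) (auto simp: inj_on_def)
    moreover have "F1 \<inter> ?t ` F2 = {}" using in_range by force
    ultimately show ?thesis
      using free_coordinatesD(1)[OF F1] free_coordinatesD(1)[OF F2] c1 by (simp add: card_Un_disjoint)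
  qed
  ultimately show ?thesis by (auto simp: has_dim_def cond_sum_def)
qed

text \<open>Free coordinates are needed only on and above the block diagonal.\<close>
lemma sym_dim_sum:
  assumes 1: "sym_dim P d1" and 2: "sym_dim Q d2" and 12: "cross_dim P Q e" and loc: "is_local P"
  shows "sym_dim (cond_sum P Q) (d1 + e + d2)"
proof -
  let ?n = "fst P" and ?m = "fst Q"
  let ?t = "\<lambda>(s::bool, i::nat, j). (s, i, ?n + j)"
  let ?u = "\<lambda>(s::bool, i, j). (s, ?n + i, ?n + j)"
  from 1 obtain F1 where F1: "free_coordinates (sym_solutions P) ?n ?n F1" and c1: "card F1 = d1"
    by (auto simp: has_dim_def)
  from 2 obtain F2 where F2: "free_coordinates (sym_solutions Q) ?m ?m F2" and c2: "card F2 = d2"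
    by (auto simp: has_dim_def)
  from 12 obtain G where G: "free_coordinates (cross_solutions P Q) ?n ?m G" and cG: "card G = e"
    by (auto simp: has_dim_def)
  let ?F = "F1 \<union> ?t ` G \<union> ?u ` F2"
  have in_range1: "i < ?n \<and> j < ?n" if "(s, i, j) \<in> F1" for s i j using free_coordinatesD(2)[OF F1] that by auto
  have in_rangeG: "i < ?n \<and> j < ?m" if "(s, i, j) \<in> G" for s i j using free_coordinatesD(2)[OF G] that by auto
  have in_range2: "i < ?m \<and> j < ?m" if "(s, i, j) \<in> F2" for s i j using free_coordinatesD(2)[OF F2] that by auto
  have "free_coordinates (sym_solutions (cond_sum P Q)) (?n + ?m) (?n + ?m) ?F"
  proof (rule free_coordinatesI)
    show "?F \<subseteq> UNIV \<times> {..<?n + ?m} \<times> {..<?n + ?m}"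
      using in_range1 in_rangeG in_range2 by fastforce
    fix f
    obtain w1 where w1: "w1 \<in> sym_solutions P" "\<forall>s i j. (s, i, j) \<in> F1 \<longrightarrow> w1 s i j = f s i j"
      using free_coordinatesD(3)[OF F1, of f] by blast
    obtain w2 where w2: "w2 \<in> sym_solutions Q"
        "\<forall>s i j. (s, i, j) \<in> F2 \<longrightarrow> w2 s i j = f s (?n + i) (?n + j)"
      using free_coordinatesD(3)[OF F2, of "\<lambda>s i j. f s (?n + i) (?n + j)"] by blast
    obtain v where v: "v \<in> cross_solutions P Q" "\<forall>s i j. (s, i, j) \<in> G \<longrightarrow> v s i j = f s i (?n + j)"
      using free_coordinatesD(3)[OF G, of "\<lambda>s i j. f s i (?n + j)"] by blast
    define w where "w = (\<lambda>s i j. if i < ?n then if j < ?n then w1 s i j else v s i (j - ?n)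
        else if j < ?n then v s j (i - ?n) else w2 s (i - ?n) (j - ?n))"
    have "w \<in> sym_solutions P"
    proof (rule sym_solutionsI)
      show "w s i j = w s j i" if "i < ?n" "j < ?n" for s i j
        using sym_solutionsD(2)[OF w1(1) that] that by (simp add: w_def)
      show "snd P (\<lambda>s. w s i)" if "i < ?n" for i
        by (rule is_localD[OF loc sym_solutionsD(1)[OF w1(1) that]]) (simp add: w_def that)
    qed
    moreover have "(\<lambda>s i j. w s i (?n + j)) \<in> cross_solutions P Q"
    proof (rule cross_solutionsI)
      show "snd Q (\<lambda>s j. w s i (?n + j))" if "i < ?n" for i
        using cross_solutionsD(1)[OF v(1) that] that by (simp add: w_def)
      show "snd P (\<lambda>s i. w s i (?n + j))" if "j < ?m" for j
        by (rule is_localD[OF loc cross_solutionsD(2)[OF v(1) that]]) (simp add: w_def)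
    qed
    moreover have "(\<lambda>s i j. w s (?n + i) (?n + j)) \<in> sym_solutions Q"
      using w2(1) by (simp add: w_def)
    moreover have "\<forall>s. \<forall>i<?n. \<forall>j<?m. w s (?n + j) i = w s i (?n + j)" by (simp add: w_def)
    ultimately have "w \<in> sym_solutions (cond_sum P Q)" unfolding sym_solutions_sum[OF loc] by blast
    moreover have "\<forall>s i j. (s, i, j) \<in> ?F \<longrightarrow> w s i j = f s i j"
      using w1(2) w2(2) v(2) in_range1 in_rangeG in_range2 by (auto simp: w_def)
    ultimately show "\<exists>w\<in>sym_solutions (cond_sum P Q). \<forall>s i j. (s, i, j) \<in> ?F \<longrightarrow> w s i j = f s i j"
      by blast
  next
    fix w s i j
    assume w: "w \<in> sym_solutions (cond_sum P Q)"
      and z: "\<And>s i j. (s, i, j) \<in> ?F \<Longrightarrow> w s i j = 0" and ij: "i < ?n + ?m" "j < ?n + ?m"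
    from w have parts: "w \<in> sym_solutions P" "(\<lambda>s i j. w s i (?n + j)) \<in> cross_solutions P Q"
        "(\<lambda>s i j. w s (?n + i) (?n + j)) \<in> sym_solutions Q"
        "\<forall>s. \<forall>i<?n. \<forall>j<?m. w s (?n + j) i = w s i (?n + j)"
      unfolding sym_solutions_sum[OF loc] by blast+
    have "w s i j = 0" if "i < ?n" "j < ?n" for i j
      by (rule free_coordinatesD(4)[OF F1 parts(1) _ that]) (simp add: z)
    moreover have "w s i (?n + j) = 0" if "i < ?n" "j < ?m" for i j
      by (rule free_coordinatesD(4)[OF G parts(2) _ that]) (rule z, force)
    moreover have "w s (?n + i) (?n + j) = 0" if "i < ?m" "j < ?m" for i j
      by (rule free_coordinatesD(4)[OF F2 parts(3) _ that]) (rule z, force)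
    ultimately have "\<forall>i<?n + ?m. \<forall>j<?n + ?m. w s i j = 0"
      unfolding all_less_add using parts(4) by simp
    then show "w s i j = 0" using ij by blast
  qed
  moreover have "card ?F = d1 + e + d2"
  proof -
    have "card (?t ` G) = e" unfolding cG[symmetric] by (rule card_image) (auto simp: inj_on_def)
    moreover have "card (?u ` F2) = d2" unfolding c2[symmetric] by (rule card_image) (auto simp: inj_on_def)
    moreover have "F1 \<inter> ?t ` G = {}" "(F1 \<union> ?t ` G) \<inter> ?u ` F2 = {}"
      using in_range1 in_rangeG by force+
    ultimately show ?thesis
      using free_coordinatesD(1)[OF F1] free_coordinatesD(1)[OF F2] free_coordinatesD(1)[OF G] c1
      by (simp add: card_Un_disjoint)
  qed
  ultimately show ?thesis by (auto simp: has_dim_def cond_sum_def)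
qed

section \<open>The elementary conditions and their solutions\<close>

text \<open>The condition of $\mathcal H_n(\lambda)$ after reversing the order of the columns: since
  multiplication by $\Delta_n$ reverses a row vector, $x\Delta_n + y\Lambda_n(\lambda) = 0$ says that $x$ is
  $-(\lambda y + {}$shift of $y)$, where the shift drops $y_0$ and appends a zero.\<close>
definition H_cond :: "nat \<Rightarrow> complex \<Rightarrow> row_cond" where
  "H_cond n l = (n, \<lambda>x. \<forall>j<n. x False j = - (l * x True j + (if Suc j < n then x True (Suc j) else 0)))"

abbreviation K_cond :: "nat \<Rightarrow> row_cond" where
  "K_cond n \<equiv> cond_swap (H_cond n 0)"

text \<open>The condition $xF_n^T + yG_n^T = 0$ on vectors of length $n+1$.\<close>
definition FT_cond :: "nat \<Rightarrow> row_cond" where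
  "FT_cond n = (Suc n, \<lambda>x. \<forall>j<n. x False j = - x True (Suc j))"

text \<open>The condition $xF_n + yG_n = 0$: column $j$ reads $x_j + y_{j-1} = 0$, where terms with an index
  outside $0,\dots,n-1$ are dropped. The second conjunct is column $n$.\<close>
definition F_cond :: "nat \<Rightarrow> row_cond" where
  "F_cond n = (n, \<lambda>x. (\<forall>j<n. x False j = (if j = 0 then 0 else - x True (j - 1))) \<and> (0 < n \<longrightarrow> x True (n - 1) = 0))"

text \<open>Up to the order of the columns, both matrices of $\mathcal L_n$ are block diagonal with a
  transposed block of size $(n+1)\times n$ and a block of size $n\times(n+1)$. This splits the
  indecomposable symmetric pair $\mathcal L_n$ into two much simpler conditions.\<close>
abbreviation L_cond :: "nat \<Rightarrow> row_cond" where
  "L_cond n \<equiv> cond_sum (FT_cond n) (F_cond n)"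

lemma is_local_H [intro]: "is_local (H_cond n l)"
  by (rule is_localI) (auto simp: H_cond_def)

lemma is_local_FT [intro]: "is_local (FT_cond n)"
  by (rule is_localI) (auto simp: FT_cond_def)

lemma is_local_F [intro]: "is_local (F_cond n)"
  by (rule is_localI) (auto simp: F_cond_def)

lemma size_conds [simp]: "fst (H_cond n l) = n" "fst (K_cond n) = n" "fst (FT_cond n) = Suc n" "fst (F_cond n) = n"
  by (simp_all add: H_cond_def cond_swap_def FT_cond_def F_cond_def)

lemma cross_dim_0I:
  assumes "(\<lambda>s i j. 0) \<in> cross_solutions P Q"
    and "\<And>w i j. \<lbrakk>w \<in> cross_solutions P Q; i < fst P; j < fst Q\<rbrakk> \<Longrightarrow> w False i j = 0 \<and> w True i j = 0"
  shows "cross_dim P Q 0"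
proof -
  have "free_coordinates (cross_solutions P Q) (fst P) (fst Q) {}"
    by (rule free_coordinatesI) (use assms in \<open>auto, metis (full_types)\<close>)
  then show ?thesis by (auto simp: has_dim_def)
qed

lemma has_dim_0D:
  assumes "has_dim S n m 0" "w \<in> S" "i < n" "j < m"
  shows "w s i j = 0"
proof -
  obtain F where F: "free_coordinates S n m F" "card F = 0" using assms(1) by (auto simp: has_dim_def)
  then have "F = {}" using free_coordinatesD(1)[OF F(1)] by simp
  then show ?thesis using free_coordinatesD(4)[OF F(1) assms(2) _ assms(3,4)] by simp
qed

lemma cross_H_H:
  "w \<in> cross_solutions (H_cond n l) (H_cond m k) \<longleftrightarrow> (\<forall>i<n. \<forall>j<m.
     w False i j = - (k * w True i j + (if Suc j < m then w True i (Suc j) else 0)) \<and>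
     w False i j = - (l * w True i j + (if Suc i < n then w True (Suc i) j else 0)))"
proof -
  have all_conj: "(\<forall>i<n. \<forall>j<m. A i j \<and> B i j) \<longleftrightarrow> (\<forall>i<n. \<forall>j<m. A i j) \<and> (\<forall>j<m. \<forall>i<n. B i j)"
    for A B :: "nat \<Rightarrow> nat \<Rightarrow> bool" by blast
  show ?thesis unfolding all_conj by (simp add: cross_solutions_def H_cond_def)
qed

lemma cross_H_H_D:
  assumes "w \<in> cross_solutions (H_cond n l) (H_cond m k)" "i < n" "j < m"
  shows "w False i j = - (k * w True i j + (if Suc j < m then w True i (Suc j) else 0))"
    "w False i j = - (l * w True i j + (if Suc i < n then w True (Suc i) j else 0))"
  using assms unfolding cross_H_H by blast+

text \<open>For different eigenvalues the two expressions for $C$ give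
  $(\lambda - \mu) D_{ij} = D_{i,j+1} - D_{i+1,j}$, where entries outside the matrix count as zero,
  and $D$ vanishes by descending induction on $i+j$.\<close>
lemma shift_zero:
  fixes D :: "nat \<Rightarrow> nat \<Rightarrow> complex"
  assumes shift: "\<And>i j. \<lbrakk>i < n; j < m\<rbrakk> \<Longrightarrow>
      c * D i j = (if Suc j < m then D i (Suc j) else 0) - (if Suc i < n then D (Suc i) j else 0)"
    and "c \<noteq> 0" "i < n" "j < m"
  shows "D i j = 0"
  using assms(3,4)
proof (induction "n + m - (i + j)" arbitrary: i j rule: less_induct)
  case less
  have "Suc j < m \<Longrightarrow> D i (Suc j) = 0" by (rule less.hyps) (use less.prems in auto)
  moreover have "Suc i < n \<Longrightarrow> D (Suc i) j = 0" by (rule less.hyps) (use less.prems in auto)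
  ultimately have "c * D i j = 0" by (simp add: shift[OF less.prems])
  then show ?case using \<open>c \<noteq> 0\<close> by simp
qed

text \<open>For equal eigenvalues $D$ is constant along antidiagonals, and an antidiagonal leaving the matrix
  through the last row or the last column carries the value zero. What survives starts in the first
  row among the first $\min(n,m)$ columns.\<close>
lemma truncated_Hankel:
  fixes D :: "nat \<Rightarrow> nat \<Rightarrow> complex"
  assumes shift: "\<And>i j. \<lbrakk>i < n; j < m\<rbrakk> \<Longrightarrow>
      (if Suc j < m then D i (Suc j) else 0) = (if Suc i < n then D (Suc i) j else 0)"
    and "i < n" "j < m"
  shows "D i j = (if i + j < min n m then D 0 (i + j) else 0)"
proof -
  \<comment> \<open>antidiagonals that reach the last row\<close>
  have right: "D i j = 0" if "n \<le> i + j" "i < n" "j < m" for i j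
    using that
  proof (induction "n - i" arbitrary: i j rule: less_induct)
    case less
    then have "D i j = (if Suc i < n then D (Suc i) (j - 1) else 0)"
      using shift[of i "j - 1"] by auto
    moreover have "Suc i < n \<Longrightarrow> D (Suc i) (j - 1) = 0" by (rule less.hyps) (use less.prems in auto)
    ultimately show ?case by simp
  qed
  show ?thesis using assms(2,3)
  proof (induction i arbitrary: j)
    case 0
    then show ?case using right[of 0 j] by auto
  next
    case (Suc i)
    have "D (Suc i) j = (if Suc j < m then D i (Suc j) else 0)"
      using shift[of i j] Suc.prems by simp
    also have "\<dots> = (if Suc i + j < min n m then D 0 (Suc i + j) else 0)"
      using Suc.IH[of "Suc j"] Suc.prems by auto
    finally show ?case .
  qed
qed

lemma cross_H_H_Hankel:
  assumes "w \<in> cross_solutions (H_cond n l) (H_cond m l)" "i < n" "j < m"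
  shows "w True i j = (if i + j < min n m then w True 0 (i + j) else 0)"
proof (rule truncated_Hankel[OF _ assms(2,3)])
  show "(if Suc j < m then w True i (Suc j) else 0) = (if Suc i < n then w True (Suc i) j else 0)"
    if "i < n" "j < m" for i j
    using cross_H_H_D[OF assms(1) that] by simp
qed

text \<open>The matrix $D$ determines $C$, so the free coordinates are those of $D$: the surviving part of its
  first row if the eigenvalues agree, and none otherwise.\<close>
lemma cross_dim_H_H: "cross_dim (H_cond n l) (H_cond m k) (if l = k then min n m else 0)"
proof (cases "l = k")
  case True
  let ?S = "cross_solutions (H_cond n l) (H_cond m l)"
  let ?F = "(\<lambda>j. (True, 0::nat, j)) ` {..<min n m}"
  have "free_coordinates ?S n m ?F"
  proof (rule free_coordinatesI)
    show "?F \<subseteq> UNIV \<times> {..<n} \<times> {..<m}" by auto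
    fix f :: pencil
    define d where "d t = (if t < min n m then f True 0 t else 0)" for t
    define w where "w s i j = (if s then d (i + j) else - (l * d (i + j) + d (Suc (i + j))))" for s i j
    have "w \<in> ?S" by (auto simp: cross_H_H w_def d_def)
    moreover have "\<forall>s i j. (s, i, j) \<in> ?F \<longrightarrow> w s i j = f s i j" by (auto simp: w_def d_def)
    ultimately show "\<exists>w\<in>?S. \<forall>s i j. (s, i, j) \<in> ?F \<longrightarrow> w s i j = f s i j" by blast
  next
    fix w s i j
    assume w: "w \<in> ?S" and z: "\<And>s i j. (s, i, j) \<in> ?F \<Longrightarrow> w s i j = 0" and ij: "i < n" "j < m"
    have D: "w True i j = 0" if "i < n" "j < m" for i j
      unfolding cross_H_H_Hankel[OF w that] using z by auto
    moreover have "w False i j = 0" using cross_H_H_D(1)[OF w ij] ij D by simp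
    ultimately show "w s i j = 0" using ij by (cases s) auto
  qed
  moreover have "card ?F = min n m" by (subst card_image) (auto simp: inj_on_def)
  ultimately show ?thesis using True by (auto simp: has_dim_def)
next
  case False
  have "cross_dim (H_cond n l) (H_cond m k) 0"
  proof (rule cross_dim_0I)
    fix w i j
    assume w: "w \<in> cross_solutions (H_cond n l) (H_cond m k)"
      and "i < fst (H_cond n l)" "j < fst (H_cond m k)"
    then have ij: "i < n" "j < m" by simp_all
    have D: "w True i j = 0" if ij: "i < n" "j < m" for i j
    proof (rule shift_zero[OF _ _ ij])
      show "(l - k) * w True i j =
          (if Suc j < m then w True i (Suc j) else 0) - (if Suc i < n then w True (Suc i) j else 0)"
        if "i < n" "j < m" for i j
      proof -
        have "k * w True i j + (if Suc j < m then w True i (Suc j) else 0) =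
            l * w True i j + (if Suc i < n then w True (Suc i) j else 0)"
          using cross_H_H_D[OF w that] by (metis neg_equal_iff_equal)
        then show ?thesis by (simp add: algebra_simps)
      qed
    qed (use False in simp)
    then show "w False i j = 0 \<and> w True i j = 0" using cross_H_H_D(1)[OF w ij] ij by simp
  qed (simp add: cross_H_H)
  then show ?thesis using False by simp
qed

lemma sym_dim_H: "sym_dim (H_cond n l) n"
proof (rule sym_dim_if_cross_symmetric)
  show "cross_dim (H_cond n l) (H_cond n l) n" using cross_dim_H_H[of n l n l] by simp
  fix w s i j
  assume w: "w \<in> cross_solutions (H_cond n l) (H_cond n l)"
    and "i < fst (H_cond n l)" "j < fst (H_cond n l)"
  then have ij: "i < n" "j < n" by simp_all
  have D: "w True i j = w True j i" if "i < n" "j < n" for i j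
    using cross_H_H_Hankel[OF w that] cross_H_H_Hankel[OF w that(2,1)] by (simp add: add.commute)
  have "w False i j = - (l * w True i j + (if Suc j < n then w True i (Suc j) else 0))"
    using cross_H_H_D(1)[OF w ij] .
  also have "\<dots> = - (l * w True j i + (if Suc j < n then w True (Suc j) i else 0))"
    using D ij by simp
  also have "\<dots> = w False j i"
    using cross_H_H_D(2)[OF w ij(2,1)] by simp
  finally show "w s i j = w s j i" using D[OF ij] by (cases s) auto
qed auto

text \<open>The row condition makes $D$ minus the left shift of $C$, and the column condition determines each
  column of $C$ from the same column of $D$. Hence columns vanish one after the other, starting from
  the last. In terms of pencils, a finite and the infinite eigenvalue do not interact.\<close>
lemma cross_dim_H_K: "cross_dim (H_cond n l) (K_cond m) 0"
proof (rule cross_dim_0I)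
  show "(\<lambda>s i j. 0) \<in> cross_solutions (H_cond n l) (K_cond m)"
    by (simp add: cross_solutions_def cond_swap_def H_cond_def)
  fix w i j
  assume w: "w \<in> cross_solutions (H_cond n l) (K_cond m)"
    and "i < fst (H_cond n l)" and "j < fst (K_cond m)"
  then have ij: "i < n" "j < m" by simp_all
  have row: "w True i j = - (if Suc j < m then w False i (Suc j) else 0)" if "i < n" "j < m" for i j
    using cross_solutionsD(1)[OF w, of i] that by (simp add: cond_swap_def H_cond_def)
  have col: "w False i j = - (l * w True i j + (if Suc i < n then w True (Suc i) j else 0))" if "i < n" "j < m" for i j
    using cross_solutionsD(2)[OF w, of j] that by (simp add: cond_swap_def H_cond_def)
  have "\<forall>i<n. w False i j = 0 \<and> w True i j = 0" using ij(2)
  proof (induction "m - j" arbitrary: j rule: less_induct)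
    case less
    have "Suc j < m \<Longrightarrow> \<forall>i<n. w False i (Suc j) = 0"
      using less.hyps[of "Suc j"] less.prems by auto
    then have "\<forall>i<n. w True i j = 0" using row less.prems by auto
    then show ?case using col less.prems by auto
  qed
  then show "w False i j = 0 \<and> w True i j = 0" using ij by blast
qed

lemma cross_dim_K_K: "cross_dim (K_cond n) (K_cond m) (min n m)"
  using cross_dim_swap[OF cross_dim_H_H[of n 0 m 0]] by simp

lemma sym_dim_K: "sym_dim (K_cond n) n"
  using sym_dim_swap[OF sym_dim_H[of n 0]] by simp

lemma cross_H_FT:
  "w \<in> cross_solutions (H_cond n l) (FT_cond m) \<longleftrightarrow>
     (\<forall>i<n. \<forall>j<m. w False i j = - w True i (Suc j)) \<and>
     (\<forall>i<n. \<forall>j\<le>m. w False i j = - (l * w True i j + (if Suc i < n then w True (Suc i) j else 0)))"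
  by (auto simp: cross_solutions_def H_cond_def FT_cond_def less_Suc_eq_le)

text \<open>The two conditions amount to the recursion $D_{\cdot,j+1} = M D_{\cdot,j}$ with $M$ the sum of
  $\lambda$ times the identity and a shift, together with $C = -MD$. The first column of $D$ is
  free and determines everything.\<close>
lemma cross_dim_H_FT: "cross_dim (H_cond n l) (FT_cond m) n"
proof -
  let ?S = "cross_solutions (H_cond n l) (FT_cond m)"
  let ?F = "(\<lambda>i. (True, i, 0::nat)) ` {..<n}"
  have "free_coordinates ?S n (Suc m) ?F"
  proof (rule free_coordinatesI)
    show "?F \<subseteq> UNIV \<times> {..<n} \<times> {..<Suc m}" by auto
    fix f :: pencil
    define step where "step v i = l * v i + (if Suc i < n then v (Suc i) else 0)" for v :: "nat \<Rightarrow> complex" and i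
    define d where "d j = (step ^^ j) (\<lambda>i. f True i 0)" for j
    define w where "w s i j = (if s then d j i else - d (Suc j) i)" for s i j
    have "d (Suc j) i = l * d j i + (if Suc i < n then d j (Suc i) else 0)" for i j
      by (simp add: d_def step_def)
    then have "w \<in> ?S" by (simp add: cross_H_FT w_def)
    moreover have "\<forall>s i j. (s, i, j) \<in> ?F \<longrightarrow> w s i j = f s i j" by (auto simp: w_def d_def)
    ultimately show "\<exists>w\<in>?S. \<forall>s i j. (s, i, j) \<in> ?F \<longrightarrow> w s i j = f s i j" by blast
  next
    fix w s i j
    assume w: "w \<in> ?S" and z: "\<And>s i j. (s, i, j) \<in> ?F \<Longrightarrow> w s i j = 0" and ij: "i < n" "j < Suc m"
    have "\<forall>i<n. w True i j = 0 \<and> w False i j = 0" if "j \<le> m" for j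
      using that
    proof (induction j)
      case 0
      have "\<forall>i<n. w True i 0 = 0" using z by auto
      then show ?case using w by (auto simp: cross_H_FT)
    next
      case (Suc j)
      have "\<forall>i<n. w True i (Suc j) = 0" using Suc w by (auto simp: cross_H_FT)
      then show ?case using w Suc.prems by (auto simp: cross_H_FT)
    qed
    then show "w s i j = 0" using ij by (cases s) auto
  qed
  moreover have "card ?F = n" by (subst card_image) (auto simp: inj_on_def)
  ultimately show ?thesis by (auto simp: has_dim_def)
qed

text \<open>Here the recursion for the columns runs in the opposite direction, $C_{\cdot,j}$ being a shift of
  $C_{\cdot,j+1}$, and the last column of $C$ is free.\<close>
lemma cross_dim_K_FT: "cross_dim (K_cond n) (FT_cond m) n"
proof -
  let ?S = "cross_solutions (K_cond n) (FT_cond m)"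
  have S: "w \<in> ?S \<longleftrightarrow>
     (\<forall>i<n. \<forall>j<m. w False i j = - w True i (Suc j)) \<and>
     (\<forall>i<n. \<forall>j\<le>m. w True i j = - (if Suc i < n then w False (Suc i) j else 0))" for w
    by (auto simp: cross_solutions_def H_cond_def cond_swap_def FT_cond_def less_Suc_eq_le)
  let ?F = "(\<lambda>i. (False, i, m)) ` {..<n}"
  have "free_coordinates ?S n (Suc m) ?F"
  proof (rule free_coordinatesI)
    show "?F \<subseteq> UNIV \<times> {..<n} \<times> {..<Suc m}" by auto
    fix f :: pencil
    define c where "c i j = (if i + (m - j) < n then f False (i + (m - j)) m else 0)" for i j
    define w where "w s i j = (if s then - (if Suc i < n then c (Suc i) j else 0) else c i j)" for s i j
    have "c i j = (if Suc i < n then c (Suc i) (Suc j) else 0)" if "i < n" "j < m" for i j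
    proof -
      have "m - j = Suc (m - Suc j)" using that by simp
      then show ?thesis using that by (auto simp: c_def)
    qed
    then have "w \<in> ?S" by (simp add: S w_def)
    moreover have "\<forall>s i j. (s, i, j) \<in> ?F \<longrightarrow> w s i j = f s i j" by (auto simp: w_def c_def)
    ultimately show "\<exists>w\<in>?S. \<forall>s i j. (s, i, j) \<in> ?F \<longrightarrow> w s i j = f s i j" by blast
  next
    fix w s i j
    assume w: "w \<in> ?S" and z: "\<And>s i j. (s, i, j) \<in> ?F \<Longrightarrow> w s i j = 0" and ij: "i < n" "j < Suc m"
    have "\<forall>i<n. w False i j = 0 \<and> w True i j = 0" if "j \<le> m" for j
      using that
    proof (induction "m - j" arbitrary: j)
      case 0
      then have "\<forall>i<n. w False i j = 0" using z by auto
      then show ?case using w 0 by (auto simp: S)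
    next
      case (Suc k)
      then have "\<forall>i<n. w True i (Suc j) = 0" using Suc(1)[of "Suc j"] by auto
      then have "\<forall>i<n. w False i j = 0" using w Suc by (auto simp: S)
      then show ?case using w Suc.prems by (auto simp: S)
    qed
    then show "w s i j = 0" using ij by (cases s) auto
  qed
  moreover have "card ?F = n" by (subst card_image) (auto simp: inj_on_def)
  ultimately show ?thesis by (auto simp: has_dim_def)
qed

text \<open>The last column of $D$ vanishes by the row condition, hence so does the last column of $C$, which
  by the row condition is minus the column of $D$ before it, and so on. For
  the condition of $\mathcal K_n$ the same happens from the first column on.\<close>
lemma cross_dim_H_F: "cross_dim (H_cond n l) (F_cond m) 0"
proof (rule cross_dim_0I)
  show "(\<lambda>s i j. 0) \<in> cross_solutions (H_cond n l) (F_cond m)"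
    by (simp add: cross_solutions_def F_cond_def H_cond_def)
  fix w i j
  assume w: "w \<in> cross_solutions (H_cond n l) (F_cond m)"
    and "i < fst (H_cond n l)" and "j < fst (F_cond m)"
  then have ij: "i < n" "j < m" by simp_all
  have row: "w True i (m - 1) = 0" "Suc j < m \<Longrightarrow> w True i j = - w False i (Suc j)" if "i < n" "j < m" for i j
    using cross_solutionsD(1)[OF w, of i] that by (auto simp: F_cond_def)
  have col: "w False i j = - (l * w True i j + (if Suc i < n then w True (Suc i) j else 0))" if "i < n" "j < m" for i j
    using cross_solutionsD(2)[OF w, of j] that by (simp add: H_cond_def)
  have "\<forall>i<n. w False i j = 0 \<and> w True i j = 0" using ij(2)
  proof (induction "m - j" arbitrary: j rule: less_induct)
    case less
    have "\<forall>i<n. w True i j = 0"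
    proof (cases "Suc j < m")
      case True
      then have "\<forall>i<n. w False i (Suc j) = 0" using less.hyps[of "Suc j"] by auto
      then show ?thesis using row(2) True by auto
    next
      case False
      then have "j = m - 1" using less.prems by auto
      then show ?thesis using row(1) less.prems by auto
    qed
    then show ?case using col less.prems by auto
  qed
  then show "w False i j = 0 \<and> w True i j = 0" using ij by blast
qed

lemma cross_dim_K_F: "cross_dim (K_cond n) (F_cond m) 0"
proof (rule cross_dim_0I)
  show "(\<lambda>s i j. 0) \<in> cross_solutions (K_cond n) (F_cond m)"
    by (simp add: cross_solutions_def F_cond_def H_cond_def cond_swap_def)
  fix w i j
  assume w: "w \<in> cross_solutions (K_cond n) (F_cond m)"
    and "i < fst (K_cond n)" and "j < fst (F_cond m)"
  then have ij: "i < n" "j < m" by simp_all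
  have row: "w False i j = (if j = 0 then 0 else - w True i (j - 1))" if "i < n" "j < m" for i j
    using cross_solutionsD(1)[OF w, of i] that by (auto simp: F_cond_def)
  have col: "w True i j = - (if Suc i < n then w False (Suc i) j else 0)" if "i < n" "j < m" for i j
    using cross_solutionsD(2)[OF w, of j] that by (simp add: H_cond_def cond_swap_def)
  have "\<forall>i<n. w False i j = 0 \<and> w True i j = 0" using ij(2)
  proof (induction j)
    case 0
    then have "\<forall>i<n. w False i 0 = 0" using row by simp
    then show ?case using col 0 by simp
  next
    case (Suc j)
    then have "\<forall>i<n. w False i (Suc j) = 0" using row by simp
    then show ?case using col Suc by simp
  qed
  then show "w False i j = 0 \<and> w True i j = 0" using ij by blast
qed

lemma cross_FT_FT:
  "w \<in> cross_solutions (FT_cond p) (FT_cond q) \<longleftrightarrow>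
     (\<forall>i\<le>p. \<forall>j<q. w False i j = - w True i (Suc j)) \<and>
     (\<forall>i<p. \<forall>j\<le>q. w False i j = - w True (Suc i) j)"
  by (auto simp: cross_solutions_def FT_cond_def less_Suc_eq_le)

lemma cross_FT_FT_D:
  assumes "w \<in> cross_solutions (FT_cond p) (FT_cond q)"
  shows "\<lbrakk>i \<le> p; j < q\<rbrakk> \<Longrightarrow> w False i j = - w True i (Suc j)"
    "\<lbrakk>i < p; j \<le> q\<rbrakk> \<Longrightarrow> w False i j = - w True (Suc i) j"
  using assms unfolding cross_FT_FT by blast+

lemma cross_FT_FT_Hankel:
  assumes "w \<in> cross_solutions (FT_cond p) (FT_cond q)" "i < p" "j < q"
  shows "w True (Suc i) j = w True i (Suc j)"
  using cross_FT_FT_D(1)[OF assms(1), of i j] cross_FT_FT_D(2)[OF assms(1), of i j] assms(2,3) by simp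

text \<open>$D$ is an arbitrary Hankel matrix, given by its first row and its last column. It determines $C$ up
  to the bottom right entry, which occurs in no equation: in all $p+q+1$ plus one free coordinates.\<close>
lemma cross_dim_FT_FT: "cross_dim (FT_cond p) (FT_cond q) (p + q + 2)"
proof -
  let ?S = "cross_solutions (FT_cond p) (FT_cond q)"
  let ?F1 = "(\<lambda>j. (True, 0::nat, j)) ` {..q}" and ?F2 = "(\<lambda>i. (True, i, q)) ` {1..p}"
  let ?F = "?F1 \<union> ?F2 \<union> {(False, p, q)}"
  have "free_coordinates ?S (Suc p) (Suc q) ?F"
  proof (rule free_coordinatesI)
    show "?F \<subseteq> UNIV \<times> {..<Suc p} \<times> {..<Suc q}" by auto
    fix f :: pencil
    define d where "d t = (if t \<le> q then f True 0 t else f True (t - q) q)" for t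
    define w where "w s i j = (if s then d (i + j) else if i = p \<and> j = q then f False p q else - d (Suc (i + j)))" for s i j
    have "w \<in> ?S" by (auto simp: cross_FT_FT w_def)
    moreover have "\<forall>s i j. (s, i, j) \<in> ?F \<longrightarrow> w s i j = f s i j" by (auto simp: w_def d_def)
    ultimately show "\<exists>w\<in>?S. \<forall>s i j. (s, i, j) \<in> ?F \<longrightarrow> w s i j = f s i j" by blast
  next
    fix w s i j
    assume w: "w \<in> ?S" and z: "\<And>s i j. (s, i, j) \<in> ?F \<Longrightarrow> w s i j = 0" and ij: "i < Suc p" "j < Suc q"
    have D: "w True i j = 0" if "i \<le> p" "j \<le> q" for i j
      using that
    proof (induction i arbitrary: j)
      case 0
      then show ?case using z by auto
    next
      case (Suc i)
      show ?case
      proof (cases "j = q")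
        case True
        then show ?thesis using z Suc.prems by auto
      next
        case False
        have "w True (Suc i) j = w True i (Suc j)"
          using Suc.prems False by (intro cross_FT_FT_Hankel[OF w]) auto
        then show ?thesis using Suc False by simp
      qed
    qed
    moreover have "w False i j = 0"
    proof (cases "i = p \<and> j = q")
      case False
      then consider "j < q" | "i < p" using ij by linarith
      then show ?thesis
        using cross_FT_FT_D[OF w, of i j] D[of i "Suc j"] D[of "Suc i" j] ij by cases auto
    qed (use z in auto)
    ultimately show "w s i j = 0" using ij by (cases s) auto
  qed
  moreover have "card ?F = p + q + 2"
  proof -
    have "card ?F1 = Suc q" by (subst card_image) (auto simp: inj_on_def)
    moreover have "card ?F2 = p" by (subst card_image) (auto simp: inj_on_def)
    moreover have "?F1 \<inter> ?F2 = {}" by auto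
    ultimately have "card (?F1 \<union> ?F2) = Suc q + p" by (simp add: card_Un_disjoint)
    moreover have "(False, p, q) \<notin> ?F1 \<union> ?F2" by auto
    ultimately show ?thesis by simp
  qed
  ultimately show ?thesis by (auto simp: has_dim_def)
qed

lemma sym_dim_FT: "sym_dim (FT_cond n) (2 * n + 2)"
proof (rule sym_dim_if_cross_symmetric)
  show "cross_dim (FT_cond n) (FT_cond n) (2 * n + 2)" using cross_dim_FT_FT[of n n] by (simp add: mult_2)
  fix w s i j
  assume w: "w \<in> cross_solutions (FT_cond n) (FT_cond n)"
    and "i < fst (FT_cond n)" "j < fst (FT_cond n)"
  then have ij: "i \<le> n" "j \<le> n" by simp_all
  have Hankel: "w True (a + t) b = w True a (b + t)" if "a + t \<le> n" "b + t \<le> n" for a b t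
    using that
  proof (induction t arbitrary: b)
    case (Suc t)
    have "w True (Suc (a + t)) b = w True (a + t) (Suc b)"
      using Suc.prems by (intro cross_FT_FT_Hankel[OF w]) auto
    then show ?case using Suc.IH[of "Suc b"] Suc.prems by simp
  qed simp
  have D: "w True i j = w True j i" if "i \<le> n" "j \<le> n" for i j
    using Hankel[of i "j - i" i] Hankel[of j "i - j" j] that by (cases "i \<le> j") auto
  have C: "w False i j = w False j i" if "i \<le> n" "j < n" for i j
  proof -
    have "w False i j = - w True i (Suc j)" using cross_FT_FT_D(1)[OF w that] .
    also have "\<dots> = - w True (Suc j) i" using D[of i "Suc j"] that by simp
    also have "\<dots> = w False j i" using cross_FT_FT_D(2)[OF w that(2,1)] by simp
    finally show ?thesis .
  qed
  have "w False i j = w False j i"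
  proof -
    consider "j < n" | "i < n" | "i = n \<and> j = n" using ij by linarith
    then show ?thesis
    proof cases
      case 1 then show ?thesis using C ij by blast
    next
      case 2 then show ?thesis using C[of j i] ij by simp
    qed simp
  qed
  then show "w s i j = w s j i" using D[OF ij] by (cases s) auto
qed auto

lemma cross_FT_F:
  "w \<in> cross_solutions (FT_cond p) (F_cond q) \<longleftrightarrow>
     (\<forall>i\<le>p. \<forall>j<q. w False i j = (if j = 0 then 0 else - w True i (j - 1))) \<and>
     (\<forall>i\<le>p. 0 < q \<longrightarrow> w True i (q - 1) = 0) \<and>
     (\<forall>i<p. \<forall>j<q. w False i j = - w True (Suc i) j)"
  by (auto simp: cross_solutions_def FT_cond_def F_cond_def less_Suc_eq_le)

text \<open>The matrix $C$ is constant along diagonals and determines $D$. A diagonal is forced to vanish when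
  it starts in the first column or meets the last column above row $p$. The remaining diagonals
  start in row $0$ in a column $j$ with $1 \le j < q - p$.\<close>
lemma cross_dim_FT_F: "cross_dim (FT_cond p) (F_cond q) (q - p - 1)"
proof -
  let ?S = "cross_solutions (FT_cond p) (F_cond q)"
  let ?F = "(\<lambda>j. (False, 0::nat, j)) ` {1..<q - p}"
  have "free_coordinates ?S (Suc p) q ?F"
  proof (rule free_coordinatesI)
    show "?F \<subseteq> UNIV \<times> {..<Suc p} \<times> {..<q}" by auto
    fix f :: pencil
    \<comment> \<open>\<open>g t\<close> is the value on the diagonal $j - i = t$; truncated subtraction sends all entries with $j \le i$ to $g\,0 = 0$\<close>
    define g where "g t = (if 0 < t \<and> t < q - p then f False 0 t else 0)" for t
    define w where "w s i j = (if s then - g (Suc j - i) else g (j - i))" for s i j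
    have "w \<in> ?S" by (auto simp: cross_FT_F w_def g_def)
    moreover have "\<forall>s i j. (s, i, j) \<in> ?F \<longrightarrow> w s i j = f s i j" by (auto simp: w_def g_def)
    ultimately show "\<exists>w\<in>?S. \<forall>s i j. (s, i, j) \<in> ?F \<longrightarrow> w s i j = f s i j" by blast
  next
    fix w s i j
    assume w: "w \<in> ?S" and z: "\<And>s i j. (s, i, j) \<in> ?F \<Longrightarrow> w s i j = 0" and ij: "i < Suc p" "j < q"
    have row: "w False i 0 = 0" "w True i (q - 1) = 0" "Suc j < q \<Longrightarrow> w True i j = - w False i (Suc j)"
      if "i \<le> p" "j < q" for i j using w that unfolding cross_FT_F by auto
    have col: "w False i j = - w True (Suc i) j" if "i < p" "j < q" for i j
      using w that unfolding cross_FT_F by blast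
    have diag: "w False i j = w False (Suc i) (Suc j)" if "i < p" "Suc j < q" for i j
      using col[of i j] row(3)[of "Suc i" j] that by simp
    \<comment> \<open>diagonals that meet the last column above row $p$, followed upwards from their end\<close>
    have end_zero: "w False i (q - Suc k) = 0" if "i + k < p" "k < q" for i k
      using that
    proof (induction k arbitrary: i)
      case 0
      then show ?case using col[of i "q - 1"] row(2)[of "Suc i" "q - 1"] by simp
    next
      case (Suc k)
      then show ?case using Suc.IH[of "Suc i"] diag[of i "q - Suc (Suc k)"] by (simp add: Suc_diff_Suc)
    qed
    have C: "w False i j = 0" if "i \<le> p" "j < q" for i j
      using that
    proof (induction i arbitrary: j)
      case 0
      consider "j = 0" | "1 \<le> j" "j < q - p" | "q - p \<le> j" by linarith
      then show ?case
      proof cases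
        case 1 then show ?thesis using row(1)[of 0 j] 0 by simp
      next
        case 2 then show ?thesis using z by auto
      next
        case 3 then show ?thesis using end_zero[of 0 "q - Suc j"] 0 by (auto simp: not_less)
      qed
    next
      case (Suc i)
      then show ?case using row(1)[of "Suc i" j] diag[of i "j - 1"] by (cases j) auto
    qed
    have "w True i j = 0"
    proof (cases "Suc j < q")
      case True
      then show ?thesis using row(3)[of i j] C[of i "Suc j"] ij by simp
    next
      case False
      then have "j = q - 1" using ij by simp
      then show ?thesis using row(2)[of i j] ij by simp
    qed
    then show "w s i j = 0" using C ij by (cases s) auto
  qed
  moreover have "card ?F = q - p - 1" by (subst card_image) (auto simp: inj_on_def)
  ultimately show ?thesis by (auto simp: has_dim_def)
qed

text \<open>By the two conditions $C_{i+1,j} = -D_{ij} = C_{i,j+1}$. Pushing an entry along its antidiagonal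
  towards the first row ends in a zero.\<close>
lemma cross_dim_F_F: "cross_dim (F_cond p) (F_cond q) 0"
proof (rule cross_dim_0I)
  show "(\<lambda>s i j. 0) \<in> cross_solutions (F_cond p) (F_cond q)"
    by (simp add: cross_solutions_def F_cond_def)
  fix w i j
  assume w: "w \<in> cross_solutions (F_cond p) (F_cond q)"
    and "i < fst (F_cond p)" and "j < fst (F_cond q)"
  then have ij: "i < p" "j < q" by simp_all
  have row: "w False i j = (if j = 0 then 0 else - w True i (j - 1))" "w True i (q - 1) = 0" if "i < p" "j < q" for i j
    using cross_solutionsD(1)[OF w, of i] that by (auto simp: F_cond_def)
  have col: "w False i j = (if i = 0 then 0 else - w True (i - 1) j)" if "i < p" "j < q" for i j
    using cross_solutionsD(2)[OF w, of j] that by (auto simp: F_cond_def)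
  have C: "w False i j = 0" if "i < p" "j < q" for i j using that
  proof (induction i arbitrary: j)
    case 0
    then show ?case using col by simp
  next
    case (Suc i)
    have "w False (Suc i) j = - w True i j" using col Suc.prems by simp
    also have "\<dots> = 0"
    proof (cases "Suc j < q")
      case True
      then show ?thesis using row(1)[of i "Suc j"] Suc by simp
    next
      case False
      then have "j = q - 1" using Suc.prems by simp
      then show ?thesis using row(2)[of i j] Suc.prems by simp
    qed
    finally show ?case .
  qed
  moreover have "w True i j = 0"
  proof (cases "Suc j < q")
    case True
    then show ?thesis using row(1)[of i "Suc j"] C[of i "Suc j"] ij by simp
  next
    case False
    then have "j = q - 1" using ij by simp
    then show ?thesis using row(2)[of i j] ij by simp
  qed
  ultimately show "w False i j = 0 \<and> w True i j = 0" using ij by blast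
qed

lemma sym_dim_F: "sym_dim (F_cond n) 0"
  by (rule sym_dim_if_cross_symmetric[OF cross_dim_F_F]) (auto simp: has_dim_0D[OF cross_dim_F_F])

section \<open>From canonical blocks to elementary conditions\<close>

definition pair_cond :: "mat_pair \<Rightarrow> row_cond" where
  "pair_cond P = (dim_row (fst P), \<lambda>x. \<forall>j<dim_row (fst P).
     (\<Sum>k<dim_row (fst P). x False k * fst P $$ (k, j) + x True k * snd P $$ (k, j)) = 0)"

lemma size_pair_cond [simp]: "fst (pair_cond P) = dim_row (fst P)"
  by (simp add: pair_cond_def)

lemma is_local_pair_cond [intro]: "is_local (pair_cond P)"
  by (rule is_localI) (simp add: pair_cond_def)

lemma pair_cond_swap:
  assumes "dim_row A = dim_row B"
  shows "pair_cond (B, A) = cond_swap (pair_cond (A, B))"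
  using assms by (simp add: pair_cond_def cond_swap_def add.commute)

lemma sum_delta_eq:
  fixes f :: "nat \<Rightarrow> complex"
  shows "(\<Sum>k<n. f k * (if k = i then 1 else 0)) = (if i < n then f i else 0)"
proof -
  have "(\<Sum>k<n. f k * (if k = i then 1 else 0)) = (\<Sum>k<n. if k = i then f k else 0)"
    by (rule sum.cong) auto
  then show ?thesis by (simp add: sum.delta)
qed

lemma all_less_rev: "(\<forall>j<n. R (n - Suc j)) \<longleftrightarrow> (\<forall>j<n. R j)" for n :: nat
  by (metis Suc_diff_Suc diff_diff_cancel diff_less_Suc less_imp_le not_less_eq zero_less_diff)

lemma H_pair_cond: "pair_cond (H_pair n l) = H_cond n l"
proof -
  have "(\<Sum>k<n. x False k * Delta_mat n $$ (k, j) + x True k * Lambda_mat n l $$ (k, j)) =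
      x False (n - Suc j) + (l * x True (n - Suc j) + (if Suc (n - Suc j) < n then x True (Suc (n - Suc j)) else 0))"
    if j: "j < n" for x :: "bool \<Rightarrow> nat \<Rightarrow> complex" and j
  proof -
    have "(\<Sum>k<n. x False k * Delta_mat n $$ (k, j) + x True k * Lambda_mat n l $$ (k, j)) =
        (\<Sum>k<n. x False k * (if k = n - Suc j then 1 else 0)
          + l * x True k * (if k = n - Suc j then 1 else 0)
          + x True k * (if k = Suc (n - Suc j) then 1 else 0))"
      by (rule sum.cong) (use j in \<open>auto simp: Delta_mat_def Lambda_mat_def\<close>)
    also have "\<dots> = x False (n - Suc j) + l * x True (n - Suc j)
        + (if Suc (n - Suc j) < n then x True (Suc (n - Suc j)) else 0)"
      unfolding sum.distrib sum_delta_eq using j by simp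
    finally show ?thesis by (simp add: add.assoc)
  qed
  note column = this
  have "(\<forall>j<n. (\<Sum>k<n. x False k * Delta_mat n $$ (k, j) + x True k * Lambda_mat n l $$ (k, j)) = 0) \<longleftrightarrow>
      (\<forall>j<n. x False j + (l * x True j + (if Suc j < n then x True (Suc j) else 0)) = 0)"
    for x :: "bool \<Rightarrow> nat \<Rightarrow> complex"
    using column[of _ x]
      all_less_rev[of n "\<lambda>j. x False j + (l * x True j + (if Suc j < n then x True (Suc j) else 0)) = 0"]
    by simp
  then show ?thesis
    unfolding pair_cond_def H_cond_def H_pair_def eq_neg_iff_add_eq_0 by (simp add: Delta_mat_def)
qed

lemma K_pair_cond: "pair_cond (K_pair n) = K_cond n"
proof -
  have "K_pair n = (snd (H_pair n 0), fst (H_pair n 0))" by (simp add: K_pair_def H_pair_def)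
  then show ?thesis
    using pair_cond_swap[of "fst (H_pair n 0)" "snd (H_pair n 0)"]
    by (simp add: H_pair_cond) (simp add: H_pair_def Delta_mat_def Lambda_mat_def)
qed

lemma sum_less_add: "(\<Sum>k<n + m. f k) = (\<Sum>k<n. f k) + (\<Sum>k<m. f (n + k))"
  for f :: "nat \<Rightarrow> complex"
  by (induction m) (auto simp: add.assoc)

text \<open>The columns with index at most $n$ of the two matrices see only the last $n$ entries of the
  vectors and give the condition of $(F_n,G_n)$; the others see only the first $n+1$ entries and give
  the condition of $(F_n^T,G_n^T)$.\<close>
lemma L_pair_cond: "pair_cond (L_pair n) = L_cond n"
proof -
  obtain A B where L: "L_pair n = (A, B)" by fastforce
  have dim: "dim_row A = Suc n + n" using L by (auto simp: L_pair_def F_mat_def)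
  have left: "(\<Sum>k<Suc n + n. x False k * A $$ (k, j) + x True k * B $$ (k, j)) =
      (if j < n then x False (Suc n + j) else 0) + (if j = 0 then 0 else x True (Suc n + (j - 1)))"
    if "j < Suc n" for x :: "bool \<Rightarrow> nat \<Rightarrow> complex" and j
  proof -
    have "(\<Sum>k<Suc n + n. x False k * A $$ (k, j) + x True k * B $$ (k, j)) =
        (\<Sum>k<Suc n. 0) + (\<Sum>k<n. x False (Suc n + k) * (if k = j then 1 else 0)
          + (if j = 0 then 0 else x True (Suc n + k) * (if k = j - 1 then 1 else 0)))"
      unfolding sum_less_add
      by (intro arg_cong2[where f = "(+)"] sum.cong)
        (use that L in \<open>auto simp: L_pair_def F_mat_def G_mat_def split: if_splits\<close>)
    also have "\<dots> = (if j < n then x False (Suc n + j) else 0) + (if j = 0 then 0 else x True (Suc n + (j - 1)))"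
      using that by (cases "j = 0") (simp_all add: sum.distrib sum_delta_eq)
    finally show ?thesis .
  qed
  have right: "(\<Sum>k<Suc n + n. x False k * A $$ (k, Suc n + j) + x True k * B $$ (k, Suc n + j)) =
      x False j + x True (Suc j)" if "j < n" for x :: "bool \<Rightarrow> nat \<Rightarrow> complex" and j
  proof -
    have "(\<Sum>k<Suc n + n. x False k * A $$ (k, Suc n + j) + x True k * B $$ (k, Suc n + j)) =
        (\<Sum>k<Suc n. x False k * (if k = j then 1 else 0) + x True k * (if k = Suc j then 1 else 0)) + (\<Sum>k<n. 0)"
      unfolding sum_less_add
      by (intro arg_cong2[where f = "(+)"] sum.cong)
        (use that L in \<open>auto simp: L_pair_def F_mat_def G_mat_def\<close>)
    also have "\<dots> = x False j + x True (Suc j)"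
      using that unfolding sum.distrib sum_delta_eq by simp
    finally show ?thesis .
  qed
  have "snd (pair_cond (L_pair n)) x \<longleftrightarrow> snd (L_cond n) x" for x
  proof -
    have "snd (pair_cond (L_pair n)) x \<longleftrightarrow> 
      (\<forall>j<Suc n. (if j < n then x False (Suc n + j) else 0) + (if j = 0 then 0 else x True (Suc n + (j - 1))) = 0)
      \<and> (\<forall>j<n. x False j + x True (Suc j) = 0)"
      unfolding L pair_cond_def fst_conv snd_conv dim all_less_add using left right by simp
    also have "\<dots> \<longleftrightarrow> snd (L_cond n) x"
      unfolding All_less_Suc cond_sum_def FT_cond_def F_cond_def by (auto simp: eq_neg_iff_add_eq_0)
    finally show ?thesis .
  qed
  moreover have "fst (pair_cond (L_pair n)) = fst (L_cond n)" by (simp add: L dim cond_sum_def)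
  ultimately show ?thesis by (intro prod_eqI ext) auto
qed

lemma pair_cond_direct_sum:
  assumes "A \<in> carrier_mat n n" "B \<in> carrier_mat n n" "C \<in> carrier_mat m m" "D \<in> carrier_mat m m"
  shows "pair_cond (four_block_mat A (0\<^sub>m n m) (0\<^sub>m m n) C, four_block_mat B (0\<^sub>m n m) (0\<^sub>m m n) D) =
    cond_sum (pair_cond (A, B)) (pair_cond (C, D))"
proof -
  let ?M = "four_block_mat A (0\<^sub>m n m) (0\<^sub>m m n) C" and ?N = "four_block_mat B (0\<^sub>m n m) (0\<^sub>m m n) D"
  have left: "(\<Sum>k<n + m. x False k * ?M $$ (k, j) + x True k * ?N $$ (k, j)) =
      (\<Sum>k<n. x False k * A $$ (k, j) + x True k * B $$ (k, j))"
    if "j < n" for x :: "bool \<Rightarrow> nat \<Rightarrow> complex" and j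
    unfolding sum_less_add using assms that by simp
  have right: "(\<Sum>k<n + m. x False k * ?M $$ (k, n + j) + x True k * ?N $$ (k, n + j)) =
      (\<Sum>k<m. x False (n + k) * C $$ (k, j) + x True (n + k) * D $$ (k, j))"
    if "j < m" for x :: "bool \<Rightarrow> nat \<Rightarrow> complex" and j
    unfolding sum_less_add using assms that by simp
  have dim: "dim_row ?M = n + m" "dim_row A = n" "dim_row C = m" using assms by auto
  show ?thesis
    unfolding pair_cond_def cond_sum_def fst_conv snd_conv dim all_less_add using left right by simp
qed

datatype block = H_block nat complex | K_block nat | L_block nat

fun block_pair :: "block \<Rightarrow> mat_pair" where
  "block_pair (H_block n l) = H_pair n l"
| "block_pair (K_block n) = K_pair n"
| "block_pair (L_block n) = L_pair n"

fun block_sym_dim :: "block \<Rightarrow> nat" where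
  "block_sym_dim (H_block n l) = n"
| "block_sym_dim (K_block n) = n"
| "block_sym_dim (L_block n) = 2 * (n + 1)"

text \<open>The values are symmetric in the two arguments, so that the order of the summands in a list is
  immaterial.\<close>
fun block_cross_dim :: "block \<Rightarrow> block \<Rightarrow> nat" where
  "block_cross_dim (H_block n l) (H_block m k) = (if l = k then min n m else 0)"
| "block_cross_dim (K_block n) (K_block m) = min n m"
| "block_cross_dim (L_block n) (L_block m) = 2 * max n m + (if n = m then 2 else 1)"
| "block_cross_dim (H_block n l) (K_block m) = 0"
| "block_cross_dim (K_block n) (H_block m l) = 0"
| "block_cross_dim (H_block n l) (L_block m) = n"
| "block_cross_dim (L_block n) (H_block m l) = m"
| "block_cross_dim (K_block n) (L_block m) = n"
| "block_cross_dim (L_block n) (K_block m) = m"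

fun block_cond :: "block \<Rightarrow> row_cond" where
  "block_cond (H_block n l) = H_cond n l"
| "block_cond (K_block n) = K_cond n"
| "block_cond (L_block n) = L_cond n"

lemma pair_cond_block: "pair_cond (block_pair b) = block_cond b"
  by (cases b) (simp_all add: H_pair_cond K_pair_cond L_pair_cond)

lemma is_local_block [intro]: "is_local (block_cond b)"
  by (cases b) auto

lemma cross_dim_H_L: "cross_dim (H_cond n l) (L_cond m) n"
  using cross_dim_sum[OF cross_dim_H_FT cross_dim_H_F is_local_FT] by simp

lemma cross_dim_K_L: "cross_dim (K_cond n) (L_cond m) n"
  using cross_dim_sum[OF cross_dim_K_FT cross_dim_K_F is_local_FT] by simp

text \<open>Of the four parts, the two mixed ones contribute $q-p-1$ and $p-q-1$ with truncated subtraction,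
  that is $|p-q|-1$ in total if $p \neq q$ and $0$ if $p = q$. Adding $p+q+2$ gives the two cases.\<close>
lemma cross_dim_L_L: "cross_dim (L_cond p) (L_cond q) (2 * max p q + (if p = q then 2 else 1))"
proof -
  have T: "cross_dim (L_cond q) (FT_cond p) (p + q + 2 + (q - p - 1))"
    by (rule cross_dim_transpose[OF cross_dim_sum[OF cross_dim_FT_FT cross_dim_FT_F is_local_FT]])
  have F: "cross_dim (L_cond q) (F_cond p) (p - q - 1 + 0)"
    by (rule cross_dim_transpose[OF cross_dim_sum[OF cross_dim_transpose[OF cross_dim_FT_F] cross_dim_F_F is_local_FT]])
  have "cross_dim (L_cond p) (L_cond q) (p + q + 2 + (q - p - 1) + (p - q - 1 + 0))"
    by (rule cross_dim_transpose[OF cross_dim_sum[OF T F is_local_FT]])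
  moreover have "p + q + 2 + (q - p - 1) + (p - q - 1 + 0) = 2 * max p q + (if p = q then 2 else 1)"
    by (cases p q rule: linorder_cases) auto
  ultimately show ?thesis by metis
qed

lemma sym_dim_L: "sym_dim (L_cond n) (2 * (n + 1))"
  using sym_dim_sum[OF sym_dim_FT sym_dim_F cross_dim_FT_F is_local_FT, of n n] by simp

lemma sym_dim_block: "sym_dim (block_cond b) (block_sym_dim b)"
  using sym_dim_H sym_dim_K sym_dim_L by (cases b) (simp_all del: size_conds)

lemma cross_dim_block: "cross_dim (block_cond b) (block_cond b') (block_cross_dim b b')"
  by (cases b; cases b'; simp only: block_cond.simps block_cross_dim.simps;
      intro cross_dim_H_H cross_dim_K_K cross_dim_L_L cross_dim_H_K cross_dim_H_L cross_dim_K_L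
        cross_dim_transpose[OF cross_dim_H_K] cross_dim_transpose[OF cross_dim_H_L] cross_dim_transpose[OF cross_dim_K_L])

definition blocks_cond :: "block list \<Rightarrow> row_cond" where
  "blocks_cond bs = foldr cond_sum (map block_cond bs) (0, \<lambda>_. True)"

fun blocks_dim :: "block list \<Rightarrow> nat" where
  "blocks_dim [] = 0"
| "blocks_dim (b # bs) = block_sym_dim b + (\<Sum>b'\<leftarrow>bs. block_cross_dim b b') + blocks_dim bs"

lemma cross_dim_blocks:
  "cross_dim (block_cond b) (blocks_cond bs) (\<Sum>b'\<leftarrow>bs. block_cross_dim b b')"
proof (induction bs)
  case Nil
  show ?case by (rule subst[of _ _ "cross_dim _ _", OF _ cross_dim_0I]) (auto simp: blocks_cond_def cross_solutions_def)
next
  case (Cons b' bs)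
  from cross_dim_sum[OF cross_dim_block[of b b'] Cons is_local_block]
  show ?case by (simp add: blocks_cond_def)
qed

lemma sym_dim_blocks: "sym_dim (blocks_cond bs) (blocks_dim bs)"
proof (induction bs)
  case Nil
  have "free_coordinates (sym_solutions (0, \<lambda>_. True)) 0 0 {}"
    by (rule free_coordinatesI) (auto simp: sym_solutions_def)
  then show ?case by (auto simp: has_dim_def blocks_cond_def)
next
  case (Cons b bs)
  from sym_dim_sum[OF sym_dim_block[of b] Cons cross_dim_blocks is_local_block]
  show ?case by (simp add: blocks_cond_def)
qed

lemma block_pair_symmetric: "\<exists>n. block_pair b \<in> symmetric_pairs n"
proof (cases b)
  case (H_block n l)
  then have "block_pair b \<in> symmetric_pairs n"
    by (auto simp: symmetric_pairs_def H_pair_def Delta_mat_def Lambda_mat_def add.commute intro!: eq_matI)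
  then show ?thesis ..
next
  case (K_block n)
  then have "block_pair b \<in> symmetric_pairs n"
    by (auto simp: symmetric_pairs_def K_pair_def Delta_mat_def Lambda_mat_def add.commute intro!: eq_matI)
  then show ?thesis ..
next
  case (L_block n)
  have F: "F_mat n \<in> carrier_mat n (n + 1)" and G: "G_mat n \<in> carrier_mat n (n + 1)"
    by (simp_all add: F_mat_def G_mat_def)
  have "block_pair b \<in> symmetric_pairs (n + 1 + n)"
    using L_block F G
      transpose_four_block_mat[OF zero_carrier_mat transpose_carrier_mat[THEN iffD2, OF F] F zero_carrier_mat]
      transpose_four_block_mat[OF zero_carrier_mat transpose_carrier_mat[THEN iffD2, OF G] G zero_carrier_mat]
    by (auto simp: symmetric_pairs_def L_pair_def)
  then show ?thesis ..
qed

lemma direct_sum_symmetric_and_cond: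
  "\<exists>n. direct_sum_pairs (map block_pair bs) \<in> symmetric_pairs n \<and>
    pair_cond (direct_sum_pairs (map block_pair bs)) = blocks_cond bs"
proof (induction bs)
  case Nil
  show ?case by (rule exI[of _ 0]) (auto simp: direct_sum_pairs_def symmetric_pairs_def pair_cond_def blocks_cond_def)
next
  case (Cons b bs)
  then obtain m where m: "direct_sum_pairs (map block_pair bs) \<in> symmetric_pairs m"
    and IH: "pair_cond (direct_sum_pairs (map block_pair bs)) = blocks_cond bs" by blast
  obtain n where n: "block_pair b \<in> symmetric_pairs n" using block_pair_symmetric by blast
  obtain A B where AB: "block_pair b = (A, B)" by fastforce
  obtain C D where CD: "direct_sum_pairs (map block_pair bs) = (C, D)" by fastforce
  have eq: "direct_sum_pairs (map block_pair (b # bs)) =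
      (four_block_mat A (0\<^sub>m n m) (0\<^sub>m m n) C, four_block_mat B (0\<^sub>m n m) (0\<^sub>m m n) D)"
    using m n AB CD by (auto simp: direct_sum_pairs_def symmetric_pairs_def Let_def)
  have car: "A \<in> carrier_mat n n" "B \<in> carrier_mat n n" "C \<in> carrier_mat m m" "D \<in> carrier_mat m m"
    and sym: "A\<^sup>T = A" "B\<^sup>T = B" "C\<^sup>T = C" "D\<^sup>T = D"
    using m n AB CD by (auto simp: symmetric_pairs_def)
  have "direct_sum_pairs (map block_pair (b # bs)) \<in> symmetric_pairs (n + m)"
    unfolding eq symmetric_pairs_def using car
    by (auto simp: sym transpose_four_block_mat[OF car(1) zero_carrier_mat zero_carrier_mat car(3)]
        transpose_four_block_mat[OF car(2) zero_carrier_mat zero_carrier_mat car(4)])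
  moreover have "pair_cond (direct_sum_pairs (map block_pair (b # bs))) = blocks_cond (b # bs)"
    unfolding eq pair_cond_direct_sum[OF car]
    using IH CD AB pair_cond_block[of b] by (simp add: blocks_cond_def)
  ultimately show ?case by blast
qed

section \<open>The normal space and its dimension\<close>

text \<open>The inverse of the map is used because the dimension formula for linear maps asks for a domain
  known to be finite-dimensional.\<close>
lemma dim_eq_if_linear_bij:
  fixes V :: "(complex, 'v) module" and T :: "'v \<Rightarrow> complex vec"
  assumes V: "vectorspace class_ring V"
    and bij: "bij_betw T (carrier V) (carrier_vec d)"
    and add: "\<And>u v. \<lbrakk>u \<in> carrier V; v \<in> carrier V\<rbrakk> \<Longrightarrow> T (u \<oplus>\<^bsub>V\<^esub> v) = T u + T v"
    and smult: "\<And>c v. v \<in> carrier V \<Longrightarrow> T (c \<odot>\<^bsub>V\<^esub> v) = c \<cdot>\<^sub>v T v"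
  shows "vectorspace.dim class_ring V = d"
proof -
  interpret V: vectorspace class_ring V by (rule V)
  interpret W: vec_space "TYPE(complex)" d .
  define S where "S = the_inv_into (carrier V) T"
  have S_in: "S x \<in> carrier V" and T_S: "T (S x) = x" if "x \<in> carrier_vec d" for x
    using bij that unfolding S_def bij_betw_def
    by (auto intro: the_inv_into_into f_the_inv_into_f)
  have S_T: "S (T v) = v" if "v \<in> carrier V" for v
    using bij that unfolding S_def bij_betw_def by (simp add: the_inv_into_f_f)
  have "S \<in> LinearCombinations.module_hom class_ring (module_vec TYPE(complex) d) V"
  proof -
    have "S (x + y) = S x \<oplus>\<^bsub>V\<^esub> S y" if "x \<in> carrier_vec d" "y \<in> carrier_vec d" for x y
      using S_T[of "S x \<oplus>\<^bsub>V\<^esub> S y"] add[of "S x" "S y"] that by (simp add: S_in T_S)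
    moreover have "S (c \<cdot>\<^sub>v x) = c \<odot>\<^bsub>V\<^esub> S x" if "x \<in> carrier_vec d" for c x
      using S_T[of "c \<odot>\<^bsub>V\<^esub> S x"] smult[of "S x" c] that by (simp add: S_in T_S)
    ultimately show ?thesis by (auto simp: LinearCombinations.module_hom_def module_vec_simps S_in)
  qed
  then interpret linear_map class_ring "module_vec TYPE(complex) d" V S
    by (intro linear_map.intro mod_hom.intro mod_hom_axioms.intro V vec_vs)
      (use V vec_vs[of d] in \<open>auto simp: vectorspace_def\<close>)
  have "bij_betw S (carrier_vec d) (carrier V)"
    unfolding S_def by (rule bij_betw_the_inv_into[OF bij])
  then have "W.dim = vectorspace.dim class_ring V"
    using dim_eq[OF W.fin_dim] by (simp add: bij_betw_def module_vec_simps)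
  then show ?thesis by (simp add: W.dim_is_n)
qed

text \<open>By symmetry of $A$ and $C$ the terms $X^TA$ and $AX$ have the same inner product with $C$, and both
  equal $\mathrm{tr}(C\overline{A}\,\overline{X})$.\<close>
lemma frobenius_inner_tangent:
  assumes A: "A \<in> carrier_mat N N" "A\<^sup>T = A" and C: "C \<in> carrier_mat N N" "C\<^sup>T = C"
    and X: "X \<in> carrier_mat N N"
  shows "frobenius_inner C (X\<^sup>T * A + A * X) =
    2 * (\<Sum>i<N. \<Sum>k<N. (\<Sum>j<N. C $$ (i, j) * cnj (A $$ (j, k))) * cnj (X $$ (k, i)))"
proof -
  have A': "A $$ (i, j) = A $$ (j, i)" if "i < N" "j < N" for i j
    using A that by (metis carrier_matD index_transpose_mat(1))
  have C': "C $$ (i, j) = C $$ (j, i)" if "i < N" "j < N" for i j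
    using C that by (metis carrier_matD index_transpose_mat(1))
  let ?t = "\<lambda>i j k. C $$ (i, j) * cnj (A $$ (j, k)) * cnj (X $$ (k, i))"
  have "frobenius_inner C (X\<^sup>T * A + A * X) =
    (\<Sum>i<N. \<Sum>j<N. C $$ (i, j) * cnj ((\<Sum>k<N. X $$ (k, i) * A $$ (k, j)) + (\<Sum>k<N. A $$ (i, k) * X $$ (k, j))))"
    unfolding frobenius_inner_def using A C X
    by (intro sum.cong) (auto simp: scalar_prod_def atLeast0LessThan)
  also have "\<dots> = (\<Sum>i<N. \<Sum>j<N. \<Sum>k<N. C $$ (i, j) * cnj (X $$ (k, i) * A $$ (k, j)))
      + (\<Sum>i<N. \<Sum>j<N. \<Sum>k<N. C $$ (i, j) * cnj (A $$ (i, k) * X $$ (k, j)))"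
    by (simp add: distrib_left sum.distrib sum_distrib_left)
  also have "(\<Sum>i<N. \<Sum>j<N. \<Sum>k<N. C $$ (i, j) * cnj (A $$ (i, k) * X $$ (k, j))) =
      (\<Sum>j<N. \<Sum>i<N. \<Sum>k<N. C $$ (i, j) * cnj (A $$ (i, k) * X $$ (k, j)))"
    by (rule sum.swap)
  also have "\<dots> = (\<Sum>i<N. \<Sum>j<N. \<Sum>k<N. ?t i j k)"
    by (intro sum.cong refl) (use C' in auto)
  also have "(\<Sum>i<N. \<Sum>j<N. \<Sum>k<N. C $$ (i, j) * cnj (X $$ (k, i) * A $$ (k, j))) =
      (\<Sum>i<N. \<Sum>j<N. \<Sum>k<N. ?t i j k)"
    by (intro sum.cong refl) (use A' in auto)
  also have "(\<Sum>i<N. \<Sum>j<N. \<Sum>k<N. ?t i j k) = (\<Sum>i<N. \<Sum>k<N. \<Sum>j<N. ?t i j k)"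
    by (intro sum.cong refl sum.swap)
  also have "\<dots> = (\<Sum>i<N. \<Sum>k<N. (\<Sum>j<N. C $$ (i, j) * cnj (A $$ (j, k))) * cnj (X $$ (k, i)))"
    by (simp add: sum_distrib_right)
  finally show ?thesis by simp
qed

text \<open>Orthogonality to the tangent space means
  $\mathrm{tr}((C\overline{A} + D\overline{B})\overline{X}) = 0$ for all $X$, that is
  $C\overline{A} + D\overline{B} = 0$.\<close>
lemma normal_space_iff:
  assumes P: "(A, B) \<in> symmetric_pairs N"
  shows "(C, D) \<in> normal_space (A, B) \<longleftrightarrow> (C, D) \<in> symmetric_pairs N \<and>
    (\<forall>i<N. \<forall>k<N. (\<Sum>j<N. C $$ (i, j) * cnj (A $$ (j, k)) + D $$ (i, j) * cnj (B $$ (j, k))) = 0)"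
    (is "_ \<longleftrightarrow> _ \<and> (\<forall>i<N. \<forall>k<N. ?r i k = 0)")
proof (cases "(C, D) \<in> symmetric_pairs N")
  case True
  have A: "A \<in> carrier_mat N N" "A\<^sup>T = A" and B: "B \<in> carrier_mat N N" "B\<^sup>T = B"
    using P by (auto simp: symmetric_pairs_def)
  have C: "C \<in> carrier_mat N N" "C\<^sup>T = C" and D: "D \<in> carrier_mat N N" "D\<^sup>T = D"
    using True by (auto simp: symmetric_pairs_def)
  have inner: "pair_inner (C, D) (X\<^sup>T * A + A * X, X\<^sup>T * B + B * X) =
      2 * (\<Sum>i<N. \<Sum>k<N. ?r i k * cnj (X $$ (k, i)))" if "X \<in> carrier_mat N N" for X
    unfolding pair_inner_def
    by (simp add: frobenius_inner_tangent[OF A C that] frobenius_inner_tangent[OF B D that] sum.distrib distrib_right)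
  have "dim_row A = N" using A by simp
  then have "(C, D) \<in> normal_space (A, B) \<longleftrightarrow>
      (\<forall>X\<in>carrier_mat N N. pair_inner (C, D) (X\<^sup>T * A + A * X, X\<^sup>T * B + B * X) = 0)"
    using True unfolding normal_space_def tangent_space_def by auto
  also have "\<dots> \<longleftrightarrow>
      (\<forall>X\<in>carrier_mat N N. (\<Sum>i<N. \<Sum>k<N. ?r i k * cnj (X $$ (k, i))) = 0)"
    by (intro ball_cong refl) (simp only: inner mult_eq_0_iff, simp)
  also have "\<dots> \<longleftrightarrow> (\<forall>i<N. \<forall>k<N. ?r i k = 0)"
  proof (intro iffI allI impI)
    fix i k assume z: "\<forall>X\<in>carrier_mat N N. (\<Sum>i<N. \<Sum>k<N. ?r i k * cnj (X $$ (k, i))) = 0"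
      and ik: "i < N" "k < N"
    \<comment> \<open>testing against a matrix unit isolates one entry\<close>
    let ?E = "mat N N (\<lambda>(p, q). if p = k \<and> q = i then 1 else 0 :: complex)"
    have "(\<Sum>i'<N. \<Sum>k'<N. ?r i' k' * cnj (?E $$ (k', i'))) =
        (\<Sum>i'<N. \<Sum>k'<N. if i' = i then if k' = k then ?r i' k' else 0 else 0)"
      by (intro sum.cong refl) auto
    also have "\<dots> = (\<Sum>i'<N. if i' = i then ?r i' k else 0)"
      by (intro sum.cong refl) (use ik in \<open>auto simp: sum.delta\<close>)
    also have "\<dots> = ?r i k" using ik by (simp add: sum.delta)
    finally show "?r i k = 0" using z[rule_format, of ?E] by (simp only: mat_carrier)
  qed simp
  finally show ?thesis using True by simp
next
  case False
  moreover have "dim_row A = N" using P by (auto simp: symmetric_pairs_def)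
  ultimately show ?thesis by (simp add: normal_space_def)
qed

text \<open>Conjugating the entries turns $C\overline{A} + D\overline{B} = 0$ into an equation with the
  coefficients $A$ and $B$ themselves. The conjugation is antilinear, which does not affect
  dimensions.\<close>
definition conj_pencil :: "mat_pair \<Rightarrow> pencil" where
  "conj_pencil Q = (\<lambda>s i j. cnj ((if s then snd Q else fst Q) $$ (i, j)))"

lemma symmetric_pairs_iff:
  "(C, D) \<in> symmetric_pairs N \<longleftrightarrow> C \<in> carrier_mat N N \<and> D \<in> carrier_mat N N \<and>
    (\<forall>i<N. \<forall>j<N. C $$ (i, j) = C $$ (j, i) \<and> D $$ (i, j) = D $$ (j, i))"
proof -
  have "X\<^sup>T = X \<longleftrightarrow> (\<forall>i<N. \<forall>j<N. X $$ (i, j) = X $$ (j, i))"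
    if X: "X \<in> carrier_mat N N" for X :: "complex mat"
  proof
    assume "X\<^sup>T = X"
    then show "\<forall>i<N. \<forall>j<N. X $$ (i, j) = X $$ (j, i)"
      using X by (metis carrier_matD index_transpose_mat(1))
  next
    assume "\<forall>i<N. \<forall>j<N. X $$ (i, j) = X $$ (j, i)"
    then show "X\<^sup>T = X" using X by (intro eq_matI) simp_all
  qed
  then show ?thesis unfolding symmetric_pairs_def by blast
qed

lemma normal_space_iff_sym_solutions:
  assumes P: "P \<in> symmetric_pairs N"
  shows "Q \<in> normal_space P \<longleftrightarrow> fst Q \<in> carrier_mat N N \<and> snd Q \<in> carrier_mat N N \<and>
    conj_pencil Q \<in> sym_solutions (pair_cond P)"
proof -
  obtain A B where P_eq: "P = (A, B)" by (cases P)
  obtain C D where Q_eq: "Q = (C, D)" by (cases Q)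
  note eq = P_eq Q_eq
  have N: "dim_row A = N" using P by (auto simp: P_eq symmetric_pairs_def)
  define u where "u = conj_pencil (C, D)"
  have zero: "(\<Sum>j<N. C $$ (i, j) * cnj (A $$ (j, k)) + D $$ (i, j) * cnj (B $$ (j, k))) = 0 \<longleftrightarrow>
      (\<Sum>j<N. u False i j * A $$ (j, k) + u True i j * B $$ (j, k)) = 0" for i k
  proof -
    have "(\<Sum>j<N. u False i j * A $$ (j, k) + u True i j * B $$ (j, k)) =
        cnj (\<Sum>j<N. C $$ (i, j) * cnj (A $$ (j, k)) + D $$ (i, j) * cnj (B $$ (j, k)))"
      by (simp add: conj_pencil_def u_def)
    then show ?thesis by (simp only: complex_cnj_zero_iff)
  qed
  have sym: "(\<forall>i<N. \<forall>j<N. C $$ (i, j) = C $$ (j, i) \<and> D $$ (i, j) = D $$ (j, i)) \<longleftrightarrow>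
      (\<forall>s. \<forall>i<N. \<forall>j<N. u s i j = u s j i)"
  proof -
    have "(\<forall>s. \<forall>i<N. \<forall>j<N. u s i j = u s j i) \<longleftrightarrow>
        (\<forall>i<N. \<forall>j<N. u True i j = u True j i) \<and> (\<forall>i<N. \<forall>j<N. u False i j = u False j i)"
      by (rule all_bool_eq)
    moreover have "u True i j = u True j i \<longleftrightarrow> D $$ (i, j) = D $$ (j, i)"
      "u False i j = u False j i \<longleftrightarrow> C $$ (i, j) = C $$ (j, i)" for i j
      by (simp_all only: u_def conj_pencil_def fst_conv snd_conv if_True if_False complex_cnj_cancel_iff)
    ultimately show ?thesis by (simp only: all_conj_distrib imp_conjR) blast
  qed
  have "u \<in> sym_solutions (pair_cond (A, B)) \<longleftrightarrow> (\<forall>s. \<forall>i<N. \<forall>j<N. u s i j = u s j i) \<and>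
      (\<forall>i<N. \<forall>k<N. (\<Sum>j<N. u False i j * A $$ (j, k) + u True i j * B $$ (j, k)) = 0)"
    by (simp only: sym_solutions_def pair_cond_def mem_Collect_eq fst_conv snd_conv N)
  then show ?thesis
    unfolding eq normal_space_iff[OF P[unfolded eq]] symmetric_pairs_iff sym zero fst_conv snd_conv
      u_def[symmetric] by blast
qed

lemma pair_space_simps [simp]:
  "carrier (pair_space N) = carrier_mat N N \<times> carrier_mat N N"
  "P \<oplus>\<^bsub>pair_space N\<^esub> Q = (fst P + fst Q, snd P + snd Q)"
  "c \<odot>\<^bsub>pair_space N\<^esub> P = (c \<cdot>\<^sub>m fst P, c \<cdot>\<^sub>m snd P)"
  "\<zero>\<^bsub>pair_space N\<^esub> = (0\<^sub>m N N, 0\<^sub>m N N)"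
  by (simp_all add: pair_space_def direct_sum_def module_mat_simps)

lemma normal_space_subspace:
  assumes P: "P \<in> symmetric_pairs N"
  shows "subspace class_ring (normal_space P) (pair_space N)"
proof -
  have vs: "vectorspace class_ring (pair_space N)"
    unfolding pair_space_def by (intro direct_sum_is_vs matrix_vs)
  note mem = normal_space_iff_sym_solutions[OF P]
  have N: "dim_row (fst P) = N" using P by (auto simp: symmetric_pairs_def)
  have sum_zero: "conj_pencil (c \<cdot>\<^sub>m fst U + fst V, c \<cdot>\<^sub>m snd U + snd V) \<in> sym_solutions (pair_cond P)"
    if U: "U \<in> normal_space P" and V: "V \<in> normal_space P" for c U V
  proof -
    have lin: "conj_pencil (c \<cdot>\<^sub>m fst U + fst V, c \<cdot>\<^sub>m snd U + snd V) s i j =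
        cnj c * conj_pencil U s i j + conj_pencil V s i j" if "i < N" "j < N" for s i j
      using U V that unfolding mem by (auto simp: conj_pencil_def)
    note u = U[unfolded mem, THEN conjunct2, THEN conjunct2]
    note v = V[unfolded mem, THEN conjunct2, THEN conjunct2]
    show ?thesis
    proof (rule sym_solutionsI)
      fix s i j assume ij: "i < fst (pair_cond P)" "j < fst (pair_cond P)"
      then show "conj_pencil (c \<cdot>\<^sub>m fst U + fst V, c \<cdot>\<^sub>m snd U + snd V) s i j =
          conj_pencil (c \<cdot>\<^sub>m fst U + fst V, c \<cdot>\<^sub>m snd U + snd V) s j i"
        using sym_solutionsD(2)[OF u ij] sym_solutionsD(2)[OF v ij] by (simp add: N lin)
    next
      fix i assume i: "i < fst (pair_cond P)"
      let ?eq = "\<lambda>x k. \<Sum>j<N. x False j * fst P $$ (j, k) + x True j * snd P $$ (j, k)"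
      let ?w = "\<lambda>s. conj_pencil (c \<cdot>\<^sub>m fst U + fst V, c \<cdot>\<^sub>m snd U + snd V) s i"
      have "?eq ?w k = cnj c * ?eq (\<lambda>s. conj_pencil U s i) k + ?eq (\<lambda>s. conj_pencil V s i) k" for k
      proof -
        have "?eq ?w k = (\<Sum>j<N. cnj c * (conj_pencil U False i j * fst P $$ (j, k) + conj_pencil U True i j * snd P $$ (j, k))
            + (conj_pencil V False i j * fst P $$ (j, k) + conj_pencil V True i j * snd P $$ (j, k)))"
          by (intro sum.cong refl) (use i in \<open>simp add: N lin algebra_simps\<close>)
        then show ?thesis by (simp only: sum.distrib sum_distrib_left distrib_left)
      qed
      then show "snd (pair_cond P) ?w"
        using sym_solutionsD(1)[OF u i] sym_solutionsD(1)[OF v i] by (simp add: pair_cond_def N)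
    qed
  qed
  have comb: "(c \<cdot>\<^sub>m fst U + fst V, c \<cdot>\<^sub>m snd U + snd V) \<in> normal_space P"
    if U: "U \<in> normal_space P" and V: "V \<in> normal_space P" for c U V
    using sum_zero[OF that] that by (auto simp: mem)
  have zero: "(0\<^sub>m N N, 0\<^sub>m N N) \<in> normal_space P"
    unfolding mem by (auto intro!: sym_solutionsI simp: conj_pencil_def pair_cond_def N)
  have "submodule class_ring (normal_space P) (pair_space N)"
  proof (rule submodule.intro)
    show "module class_ring (pair_space N)" using vs by (simp add: vectorspace_def)
    show "normal_space P \<subseteq> carrier (pair_space N)" by (auto simp: mem)
    show "\<zero>\<^bsub>pair_space N\<^esub> \<in> normal_space P" by (simp add: zero)
    show "U \<oplus>\<^bsub>pair_space N\<^esub> V \<in> normal_space P" if "U \<in> normal_space P" "V \<in> normal_space P" for U V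
    proof -
      have "1 \<cdot>\<^sub>m X = X" for X :: "complex mat" by (rule eq_matI) simp_all
      then show ?thesis using comb[OF that, of 1] by simp
    qed
    show "c \<odot>\<^bsub>pair_space N\<^esub> U \<in> normal_space P" if "U \<in> normal_space P" for c U
    proof -
      have "c \<cdot>\<^sub>m fst U + 0\<^sub>m N N = c \<cdot>\<^sub>m fst U" "c \<cdot>\<^sub>m snd U + 0\<^sub>m N N = c \<cdot>\<^sub>m snd U"
        using that by (auto simp: mem)
      then show ?thesis using comb[OF that zero, of c] by simp
    qed
  qed
  with vs show ?thesis by (simp add: subspace_def)
qed

text \<open>Reading off the free coordinates of a pair in the normal space is a linear bijection onto
  $\mathbb C^d$.\<close>
lemma codim_eq_if_sym_dim:
  assumes P: "P \<in> symmetric_pairs N" and dim: "sym_dim (pair_cond P) d"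
  shows "codim_congruence_orbit P = d"
proof -
  have N: "dim_row (fst P) = N" using P by (auto simp: symmetric_pairs_def)
  note mem = normal_space_iff_sym_solutions[OF P]
  obtain F where F: "free_coordinates (sym_solutions (pair_cond P)) N N F" and card: "card F = d"
    using dim by (auto simp: has_dim_def N)
  obtain e where e: "bij_betw e {..<d} F"
    using ex_bij_betw_nat_finite[OF free_coordinatesD(1)[OF F]] card by (auto simp: atLeast0LessThan)
  define coord where "coord Q x = (case x of (s, i, j) \<Rightarrow> (if s then snd Q else fst Q) $$ (i, j))"
    for Q :: mat_pair and x :: "bool \<times> nat \<times> nat"
  define T where "T Q = vec d (\<lambda>n. coord Q (e n))" for Q
  have in_F: "e n \<in> F" if "n < d" for n using e that by (auto simp: bij_betw_def)
  have range: "i < N \<and> j < N" if "(s, i, j) \<in> F" for s i j using free_coordinatesD(2)[OF F] that by auto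
  let ?V = "pair_space N\<lparr>carrier := normal_space P\<rparr>"
  have vs: "vectorspace class_ring ?V"
    using normal_space_subspace[OF P] vectorspace.subspace_is_vs subspace.vs by blast
  have add: "T (U \<oplus>\<^bsub>?V\<^esub> W) = T U + T W" if "U \<in> normal_space P" "W \<in> normal_space P" for U W
  proof (rule eq_vecI)
    fix n assume "n < dim_vec (T U + T W)"
    then have n: "n < d" by (simp add: T_def)
    obtain s i j where x: "e n = (s, i, j)" by (cases "e n") auto
    then show "T (U \<oplus>\<^bsub>?V\<^esub> W) $ n = (T U + T W) $ n"
      using range[of s i j] in_F[OF n] n that by (auto simp: T_def coord_def mem)
  qed (simp add: T_def)
  have smult: "T (c \<odot>\<^bsub>?V\<^esub> U) = c \<cdot>\<^sub>v T U" if "U \<in> normal_space P" for c U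
  proof (rule eq_vecI)
    fix n assume "n < dim_vec (c \<cdot>\<^sub>v T U)"
    then have n: "n < d" by (simp add: T_def)
    obtain s i j where x: "e n = (s, i, j)" by (cases "e n") auto
    then show "T (c \<odot>\<^bsub>?V\<^esub> U) $ n = (c \<cdot>\<^sub>v T U) $ n"
      using range[of s i j] in_F[OF n] n that by (auto simp: T_def coord_def mem)
  qed (simp add: T_def)
  have "inj_on T (normal_space P)"
  proof (rule inj_onI)
    fix U W assume U: "U \<in> normal_space P" and W: "W \<in> normal_space P" and eq: "T U = T W"
    interpret V: vectorspace class_ring ?V by (rule vs)
    \<comment> \<open>the difference of \<open>U\<close> and \<open>W\<close>, which lies in the normal space and vanishes on \<open>F\<close>\<close>
    define Q where "Q = U \<oplus>\<^bsub>?V\<^esub> ((-1) \<odot>\<^bsub>?V\<^esub> W)"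
    have Q: "Q \<in> normal_space P" unfolding Q_def
      using V.a_closed[of U "(-1) \<odot>\<^bsub>?V\<^esub> W"] V.smult_closed[of "-1" W] U W by simp
    have Q_entry: "coord Q (s, i, j) = coord U (s, i, j) - coord W (s, i, j)" if "i < N" "j < N" for s i j
      using U W that by (auto simp: Q_def coord_def mem)
    have "conj_pencil Q s i j = 0" if "i < N" "j < N" for s i j
    proof (rule free_coordinatesD(4)[OF F _ _ that])
      show "conj_pencil Q \<in> sym_solutions (pair_cond P)" using Q by (simp add: mem)
      fix s i j assume x: "(s, i, j) \<in> F"
      then obtain n where "n < d" "e n = (s, i, j)" using e by (auto simp: bij_betw_def)
      then have "coord U (s, i, j) = coord W (s, i, j)" using arg_cong[OF eq, of "\<lambda>v. v $ n"] by (simp add: T_def)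
      then show "conj_pencil Q s i j = 0"
        using Q_entry range[OF x] by (auto simp: conj_pencil_def coord_def)
    qed
    then have "coord U (s, i, j) = coord W (s, i, j)" if "i < N" "j < N" for s i j
      using that Q_entry[OF that, of s] by (auto simp: conj_pencil_def coord_def)
    from this[of _ _ False] this[of _ _ True] show "U = W"
      using U W by (intro prod_eqI eq_matI) (auto simp: mem coord_def)
  qed
  moreover have "T ` normal_space P = carrier_vec d"
  proof (intro equalityI subsetI)
    fix v :: "complex vec" assume v: "v \<in> carrier_vec d"
    define e' where "e' = the_inv_into {..<d} e"
    obtain w where w: "w \<in> sym_solutions (pair_cond P)"
      and val: "\<forall>s i j. (s, i, j) \<in> F \<longrightarrow> w s i j = cnj (v $ e' (s, i, j))"
      using free_coordinatesD(3)[OF F, of "\<lambda>s i j. cnj (v $ e' (s, i, j))"] by blast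
    define Q where "Q = (mat N N (\<lambda>(i, j). cnj (w False i j)), mat N N (\<lambda>(i, j). cnj (w True i j)))"
    have Q_w: "conj_pencil Q s i j = w s i j" if "i < N" "j < N" for s i j
      using that by (cases s) (auto simp: Q_def conj_pencil_def)
    have "conj_pencil Q \<in> sym_solutions (pair_cond P)"
    proof (rule sym_solutionsI)
      show "conj_pencil Q s i j = conj_pencil Q s j i" if "i < fst (pair_cond P)" "j < fst (pair_cond P)" for s i j
        using sym_solutionsD(2)[OF w that] that by (simp add: Q_w N)
      show "snd (pair_cond P) (\<lambda>s. conj_pencil Q s i)" if "i < fst (pair_cond P)" for i
        by (rule is_localD[OF is_local_pair_cond sym_solutionsD(1)[OF w that]]) (use that in \<open>simp add: Q_w N\<close>)
    qed
    then have "Q \<in> normal_space P" unfolding mem by (simp add: Q_def)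
    moreover have "T Q = v"
    proof (rule eq_vecI)
      fix n assume "n < dim_vec v"
      then have n: "n < d" using v by simp
      obtain s i j where x: "e n = (s, i, j)" by (cases "e n") auto
      have "e' (s, i, j) = n" using e n unfolding e'_def x[symmetric]
        by (simp add: bij_betw_def the_inv_into_f_f)
      then have "w s i j = cnj (v $ n)" using val in_F[OF n] x by simp
      then show "T Q $ n = v $ n" using n x range[of s i j] in_F[OF n]
        by (cases s) (auto simp: T_def coord_def Q_def)
    qed (use v in \<open>simp add: T_def\<close>)
    ultimately show "v \<in> T ` normal_space P" by blast
  qed (auto simp: T_def)
  ultimately have "bij_betw T (carrier ?V) (carrier_vec d)" by (simp add: bij_betw_def)
  from dim_eq_if_linear_bij[OF vs this] add smult
  show ?thesis by (simp add: codim_congruence_orbit_def N)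
qed

section \<open>Summation over the canonical form\<close>
lemma blocks_dim_append:
  "blocks_dim (xs @ ys) = blocks_dim xs + (\<Sum>x\<leftarrow>xs. \<Sum>y\<leftarrow>ys. block_cross_dim x y) + blocks_dim ys"
  by (induction xs) auto

lemma sum_pairs_less_Suc:
  fixes f :: "nat \<Rightarrow> nat \<Rightarrow> nat"
  shows "(\<Sum>(i, j) \<in> {(i, j). i < j \<and> j < Suc n \<and> R i j}. f i j) =
    (\<Sum>(i, j) \<in> {(i, j). i < j \<and> j < n \<and> R i j}. f i j) + (\<Sum>i<n. if R i n then f i n else 0)"
proof -
  have fin: "finite {(i, j). i < j \<and> j < n \<and> R i j}"
    by (rule finite_subset[of _ "{..<n} \<times> {..<n}"]) auto
  have "{(i, j). i < j \<and> j < Suc n \<and> R i j} =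
      {(i, j). i < j \<and> j < n \<and> R i j} \<union> (\<lambda>i. (i, n)) ` {i. i < n \<and> R i n}"
    by (auto simp: less_Suc_eq)
  moreover have "(\<Sum>(i, j) \<in> (\<lambda>i. (i, n)) ` {i. i < n \<and> R i n}. f i j) = (\<Sum>i | i < n \<and> R i n. f i n)"
    by (subst sum.reindex) (auto simp: inj_on_def)
  moreover have "\<dots> = (\<Sum>i<n. if R i n then f i n else 0)"
    by (simp add: sum.inter_filter[symmetric] lessThan_def)
  moreover have "{(i, j). i < j \<and> j < n \<and> R i j} \<inter> (\<lambda>i. (i, n)) ` {i. i < n \<and> R i n} = {}" by auto
  ultimately show ?thesis using fin by (simp add: sum.union_disjoint)
qed

lemma blocks_dim_map_upt:
  assumes "\<And>i j. block_cross_dim (g i) (g j) = (if R i j then f i j else 0)"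
  shows "blocks_dim (map g [0..<n]) =
    (\<Sum>i<n. block_sym_dim (g i)) + (\<Sum>(i, j) \<in> {(i, j). i < j \<and> j < n \<and> R i j}. f i j)"
proof (induction n)
  case (Suc n)
  have "(\<Sum>x\<leftarrow>map g [0..<n]. block_cross_dim x (g n)) = (\<Sum>i<n. if R i n then f i n else 0)"
    by (simp add: assms sum_list_distinct_conv_sum_set atLeast0LessThan o_def)
  then show ?case using Suc by (simp add: blocks_dim_append sum_pairs_less_Suc)
qed simp

theorem corollary2p1:
  fixes a b c :: nat
    and h k l :: "nat \<Rightarrow> nat"
    and lam :: "nat \<Rightarrow> complex"
  assumes "\<And>i. i < a \<Longrightarrow> h i \<ge> 1"
    and "\<And>j. j < b \<Longrightarrow> k j \<ge> 1"
  shows "codim_congruence_orbit (canonical_pair a h lam b k c l) =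
    (let cH = (\<Sum>i<a. h i);
         cK = (\<Sum>j<b. k j);
         cL = 2 * (\<Sum>r<c. l r + 1);
         cHH = (\<Sum>(i, i') \<in> {(i, i'). i < i' \<and> i' < a \<and> lam i = lam i'}. min (h i) (h i'));
         cKK = (\<Sum>(j, j') \<in> {(j, j'). j < j' \<and> j' < b}. min (k j) (k j'));
         cLL = (\<Sum>(r, r') \<in> {(r, r'). r < r' \<and> r' < c}.
                  2 * max (l r) (l r') + (if l r = l r' then 2 else 1));
         cHK = 0;
         cHL = c * (\<Sum>i<a. h i);
         cKL = c * (\<Sum>j<b. k j)
     in cH + cK + cL + cHH + cKK + cLL + cHK + cHL + cKL)"
proof -
  define Hs where "Hs = map (\<lambda>i. H_block (h i) (lam i)) [0..<a]"
  define Ks where "Ks = map (\<lambda>j. K_block (k j)) [0..<b]"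
  define Ls where "Ls = map (\<lambda>r. L_block (l r)) [0..<c]"
  let ?P = "canonical_pair a h lam b k c l"
  have P: "?P = direct_sum_pairs (map block_pair (Hs @ Ks @ Ls))"
    by (simp add: canonical_pair_def Hs_def Ks_def Ls_def o_def)
  obtain n where "?P \<in> symmetric_pairs n" "pair_cond ?P = blocks_cond (Hs @ Ks @ Ls)"
    using direct_sum_symmetric_and_cond[of "Hs @ Ks @ Ls"] unfolding P by blast
  then have "codim_congruence_orbit ?P = blocks_dim (Hs @ Ks @ Ls)"
    using sym_dim_blocks[of "Hs @ Ks @ Ls"] by (intro codim_eq_if_sym_dim) simp_all
  moreover have "blocks_dim Hs = (\<Sum>i<a. h i) +
      (\<Sum>(i, i') \<in> {(i, i'). i < i' \<and> i' < a \<and> lam i = lam i'}. min (h i) (h i'))"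
    unfolding Hs_def by (subst blocks_dim_map_upt[where R = "\<lambda>i i'. lam i = lam i'"]) auto
  moreover have "blocks_dim Ks = (\<Sum>j<b. k j) +
      (\<Sum>(j, j') \<in> {(j, j'). j < j' \<and> j' < b}. min (k j) (k j'))"
    unfolding Ks_def
    by (subst blocks_dim_map_upt[where R = "\<lambda>_ _. True" and f = "\<lambda>j j'. min (k j) (k j')"]) auto
  moreover have "blocks_dim Ls = 2 * (\<Sum>r<c. l r + 1) + (\<Sum>(r, r') \<in> {(r, r'). r < r' \<and> r' < c}.
      2 * max (l r) (l r') + (if l r = l r' then 2 else 1))"
    unfolding Ls_def
    by (subst blocks_dim_map_upt[where R = "\<lambda>_ _. True" and
          f = "\<lambda>r r'. 2 * max (l r) (l r') + (if l r = l r' then 2 else 1)"])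
      (simp_all add: sum_distrib_left)
  moreover have "(\<Sum>x\<leftarrow>Hs. \<Sum>y\<leftarrow>Ks @ Ls. block_cross_dim x y) = c * (\<Sum>i<a. h i)"
    by (simp add: Hs_def Ks_def Ls_def o_def sum_list_distinct_conv_sum_set atLeast0LessThan sum_distrib_left)
  moreover have "(\<Sum>x\<leftarrow>Ks. \<Sum>y\<leftarrow>Ls. block_cross_dim x y) = c * (\<Sum>j<b. k j)"
    by (simp add: Ks_def Ls_def o_def sum_list_distinct_conv_sum_set atLeast0LessThan sum_distrib_left)
  ultimately show ?thesis by (simp only: blocks_dim_append Let_def)
qed

end
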